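(* Let $k$ be a field of characteristic $0$, let $R$ be a finite field extension of $k$, let $A=R[\mathcal S,\mathcal D;\sigma,\delta]$ be a differential difference algebra over $R$, let $p\ge1$, and fix a DD-monomial ordering on the set $\mathcal N$ of monomials of the free left $A$-module $A^p$. Let $G$ be a subset of $A^p$ consisting of nonzero elements and let $M$ be the submodule of $A^p$ generated by $G$. Then $G$ is a left Gröbner-Shirshov basis for $M$ if and only if $\operatorname{Svect}(g_i,g_j)$ can be reduced to $0$ by $G$ for all $g_i,g_j\in G$.
   Context: All algebras are unital associative $k$-algebras; $\mathbb N$ includes $0$. A derivation on an algebra $R$ is a $k$-linear map $\delta$ with $\delta(ab)=a\delta(b)+\delta(a)b$. $R\langle a_1,\dots,a_s\rangle$ denotes the subalgebra generated by $R$ and $a_1,\dots,a_s$. Differential difference algebra: an algebra $A$ is a differential difference algebra of type $(m,n)$ ($m,n\in\mathbb N$) over a subalgebra $R\subseteq A$, written $A=R[\mathcal S,\mathcal D;\sigma,\delta]$, if there are elements $S_1,\dots,S_m,D_1,\dots,D_n\in A$ such that: (i) the elements $S_1^{\alpha_1}\cdots S_m^{\alpha_m}D_1^{\beta_1}\cdots D_n^{\beta_n}$ ($\alpha_i,\beta_j\in\mathbb N$) form a basis of $A$ as a free left $R$-module; (ii) $D_ir=rD_i+\delta_i(r)$ for $r\in R$, $1\le i\le n$, with $\delta_i$ a derivation on $R$; (iii) $S_ir=\sigma_i^{-1}(r)S_i$ (equivalently $rS_i=S_i\sigma_i(r)$) for $r\in R$, $1\le i\le m$, where $\sigma_i$ is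 a $k$-algebra automorphism of $R\langle D_1,\dots,D_n\rangle$ restricting to an automorphism of $R$ and with $\sigma_i(D_j)=\sum_{s=1}^n a_{ijs}D_s$, $a_{ijs}\in R$; (iv) $D_iS_j=S_j\sigma_j(D_i)$; (v) the $S_i$ commute with each other and the $D_j$ commute with each other; (vi) the $\delta_i$ commute with each other and the $\sigma_i$ commute with each other. These elements are fixed. Put $l=m+n$, $x_i=S_i$ ($1\le i\le m$), $x_{m+j}=D_j$ ($1\le j\le n$), $X^\alpha=x_1^{\alpha_1}\cdots x_l^{\alpha_l}$. Let $e_1,\dots,e_p$ be the standard basis of $A^p$; $\mathcal N=\{X^\alpha e_i:\alpha\in\mathbb N^l,1\le i\le p\}$, an $R$-basis of $A^p$. For a total order on $\mathcal N$ and $0\ne f\in A^p$, $\operatorname{lm}(f)$ is the largest monomial occurring in $f$ with nonzero coefficient, $\operatorname{lc}(f)$ its coefficient, $\operatorname{lt}(f)=\operatorname{lc}(f)\operatorname{lm}(f)$. $X^\alpha e_i$ is right divisible by $X^\beta e_j$ iff $i=j$ and $\alpha_s\ge\beta_s$ for all $s$ (equivalently $i=j$ and $X^\alpha=hX^\beta$ for some $h\in A$). A DD-monomial ordering on $\mathcal N$ is a (total) well-ordering $>$ such that $u>v$ implies $\operatorname{lm}(fu)>\operatorname{lm}(fv)$ for all $u,v\in\mathcal N$, $0\neq f\in A$. A subset $G\subseteq M$ (of nonzero elements) is a left Gröbner-Shirshov basis for $M$ if for every $0\ne f\in M$ there is $g\in G$ with $\operatorname{lm}(f)$ right divisible by $\operatorname{lm}(g)$.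 $\operatorname{lclm}(X^\alpha e_i,X^\beta e_j)=0$ if $i\ne j$, and $=X^\gamma e_i$ with $\gamma_s=\max\{\alpha_s,\beta_s\}$ if $i=j$. For nonzero $f,g\in A^p$ and $w=\operatorname{lclm}(\operatorname{lm}(f),\operatorname{lm}(g))$, let $a,b\in A$ be the unique elements with $a\operatorname{lt}(f)=w=b\operatorname{lt}(g)$ (left quotients); then $\operatorname{Svect}(f,g)=af-bg$ (so $\operatorname{Svect}(f,g)=0$ if $w=0$). An element $f\in A^p$ can be reduced to $0$ by $G$ if $f=0$ or $f=a_1g_1+\cdots+a_qg_q$ for some $q\in\mathbb N$, $g_i\in G$, $a_i\in A$ with $\operatorname{lm}(a_ig_i)\le\operatorname{lm}(f)$ for each $i$ with $a_ig_i\ne0$. *)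

theory Defs
  imports "HOL-Analysis.Finite_Cartesian_Product"
begin

section \<open>Algebras over a field\<close>

locale k_algebra = vector_space smul
  for smul :: "'k::field \<Rightarrow> 'a::ring_1 \<Rightarrow> 'a" +
  assumes scale_mult_left: "smul c (x * y) = smul c x * y"
    and scale_mult_right: "smul c (x * y) = x * smul c y"

definition subalgebra :: "('k::field \<Rightarrow> 'a::ring_1 \<Rightarrow> 'a) \<Rightarrow> 'a set \<Rightarrow> bool" where
  "subalgebra smul T \<longleftrightarrow>
     module.subspace smul T \<and> 1 \<in> T \<and> (\<forall>x\<in>T. \<forall>y\<in>T. x * y \<in> T)"

definition derivation_on :: "('k::field \<Rightarrow> 'a::ring_1 \<Rightarrow> 'a) \<Rightarrow> 'a set \<Rightarrow> ('a \<Rightarrow> 'a) \<Rightarrow> bool" where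
  "derivation_on smul T d \<longleftrightarrow>
     (\<forall>x\<in>T. d x \<in> T) \<and>
     (\<forall>x\<in>T. \<forall>y\<in>T. d (x + y) = d x + d y) \<and>
     (\<forall>c. \<forall>x\<in>T. d (smul c x) = smul c (d x)) \<and>
     (\<forall>x\<in>T. \<forall>y\<in>T. d (x * y) = x * d y + d x * y)"

definition algebra_automorphism_on ::
    "('k::field \<Rightarrow> 'a::ring_1 \<Rightarrow> 'a) \<Rightarrow> 'a set \<Rightarrow> ('a \<Rightarrow> 'a) \<Rightarrow> bool" where
  "algebra_automorphism_on smul T f \<longleftrightarrow>
     bij_betw f T T \<and> f 1 = 1 \<and>
     (\<forall>x\<in>T. \<forall>y\<in>T. f (x + y) = f x + f y) \<and>
     (\<forall>c. \<forall>x\<in>T. f (smul c x) = smul c (f x)) \<and>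
     (\<forall>x\<in>T. \<forall>y\<in>T. f (x * y) = f x * f y)"

text \<open>The field \<open>k\<close> is embedded in \<open>R\<close> by \<open>c \<mapsto> smul c 1\<close>.\<close>

definition finite_field_extension :: "('k::field \<Rightarrow> 'a::ring_1 \<Rightarrow> 'a) \<Rightarrow> 'a set \<Rightarrow> bool" where
  "finite_field_extension smul R \<longleftrightarrow>
     subalgebra smul R \<and>
     (\<forall>x\<in>R. \<forall>y\<in>R. x * y = y * x) \<and>
     (\<forall>x\<in>R. x \<noteq> 0 \<longrightarrow> (\<exists>y\<in>R. x * y = 1)) \<and>
     (\<exists>B. finite B \<and> B \<subseteq> R \<and> module.span smul B = R)"


section \<open>Bases of free left modules\<close>

text \<open>
  The library's modules have commutative scalars given by a whole type. Here the scalars form a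
  subset \<open>R\<close> of a noncommutative ring, acting by \<open>act\<close>, and \<open>b\<close> is a family of vectors
  indexed by the set \<open>I\<close>.
\<close>

definition coeff_family :: "'r::zero set \<Rightarrow> 'i set \<Rightarrow> ('i \<Rightarrow> 'r) \<Rightarrow> bool" where
  "coeff_family R I c \<longleftrightarrow>
     range c \<subseteq> R \<and> finite {i. c i \<noteq> 0} \<and> {i. c i \<noteq> 0} \<subseteq> I"

definition lin_comb ::
    "('r::zero \<Rightarrow> 'v \<Rightarrow> 'v::comm_monoid_add) \<Rightarrow> ('i \<Rightarrow> 'v) \<Rightarrow> ('i \<Rightarrow> 'r) \<Rightarrow> 'v" where
  "lin_comb act b c = (\<Sum>i | c i \<noteq> 0. act (c i) (b i))"

definition left_basis ::
    "('r::zero \<Rightarrow> 'v \<Rightarrow> 'v::comm_monoid_add) \<Rightarrow> 'r set \<Rightarrow> 'i set \<Rightarrow> ('i \<Rightarrow> 'v) \<Rightarrow> bool" where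
  "left_basis act R I b \<longleftrightarrow> (\<forall>v. \<exists>!c. coeff_family R I c \<and> v = lin_comb act b c)"

definition coords ::
    "('r::zero \<Rightarrow> 'v \<Rightarrow> 'v::comm_monoid_add) \<Rightarrow> 'r set \<Rightarrow> 'i set \<Rightarrow> ('i \<Rightarrow> 'v) \<Rightarrow> 'v \<Rightarrow> 'i \<Rightarrow> 'r" where
  "coords act R I b v = (THE c. coeff_family R I c \<and> v = lin_comb act b c)"


section \<open>Differential difference algebras\<close>

text \<open>
  All indices start at \<open>0\<close>, so that \<open>S\<close> is used on \<open>{..<m}\<close>, \<open>D\<close> on \<open>{..<n}\<close>, and the
  combined generators \<open>x\<close> on \<open>{..<m + n}\<close>.
  Elements of \<open>\<nat>\<^sup>l\<close> are functions on \<open>nat\<close> that vanish from \<open>l\<close> on.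
\<close>

definition expos :: "nat \<Rightarrow> (nat \<Rightarrow> nat) set" where
  "expos l = {\<alpha>. \<forall>i\<ge>l. \<alpha> i = 0}"

definition gens :: "nat \<Rightarrow> (nat \<Rightarrow> 'a) \<Rightarrow> (nat \<Rightarrow> 'a) \<Rightarrow> nat \<Rightarrow> 'a" where
  "gens m S D i = (if i < m then S i else D (i - m))"

definition Xpow :: "nat \<Rightarrow> (nat \<Rightarrow> 'a::ring_1) \<Rightarrow> (nat \<Rightarrow> nat) \<Rightarrow> 'a" where
  "Xpow l x \<alpha> = prod_list (map (\<lambda>i. x i ^ \<alpha> i) [0..<l])"

definition dd_algebra ::
    "('k::field \<Rightarrow> 'a::ring_1 \<Rightarrow> 'a) \<Rightarrow> 'a set \<Rightarrow> nat \<Rightarrow> nat \<Rightarrow> (nat \<Rightarrow> 'a) \<Rightarrow> (nat \<Rightarrow> 'a) \<Rightarrow>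
     (nat \<Rightarrow> 'a \<Rightarrow> 'a) \<Rightarrow> (nat \<Rightarrow> 'a \<Rightarrow> 'a) \<Rightarrow> bool" where
  "dd_algebra smul R m n S D \<sigma> \<delta> \<longleftrightarrow>
     k_algebra smul \<and> subalgebra smul R \<and>
     (let T = subalgebra smul hull (R \<union> D ` {..<n}) in
       left_basis (*) R (expos (m + n)) (Xpow (m + n) (gens m S D)) \<and>
       (\<forall>i<n. derivation_on smul R (\<delta> i) \<and> (\<forall>r\<in>R. D i * r = r * D i + \<delta> i r)) \<and>
       (\<forall>i<m. algebra_automorphism_on smul T (\<sigma> i) \<and> algebra_automorphism_on smul R (\<sigma> i) \<and>
              (\<forall>j<n. \<exists>a. (\<forall>s<n. a s \<in> R) \<and> \<sigma> i (D j) = (\<Sum>s<n. a s * D s)) \<and>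
              (\<forall>r\<in>R. S i * r = inv_into T (\<sigma> i) r * S i)) \<and>
       (\<forall>i<n. \<forall>j<m. D i * S j = S j * \<sigma> j (D i)) \<and>
       (\<forall>i<m. \<forall>j<m. S i * S j = S j * S i) \<and>
       (\<forall>i<n. \<forall>j<n. D i * D j = D j * D i) \<and>
       (\<forall>i<n. \<forall>j<n. \<forall>r\<in>R. \<delta> i (\<delta> j r) = \<delta> j (\<delta> i r)) \<and>
       (\<forall>i<m. \<forall>j<m. \<forall>t\<in>T. \<sigma> i (\<sigma> j t) = \<sigma> j (\<sigma> i t)))"


section \<open>Monomials in the free left module\<close>

text \<open>
  The free module \<open>A\<^sup>p\<close> is \<open>'a ^ 'p\<close> with \<open>p = CARD('p)\<close>, the left action \<open>vector_scalar_mult\<close>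
  and the standard basis \<open>axis i 1\<close>. The monomials are the vectors \<open>X\<^sup>\<alpha> e\<^sub>i\<close> themselves.
\<close>

definition monom_vec :: "nat \<Rightarrow> (nat \<Rightarrow> 'a::ring_1) \<Rightarrow> (nat \<Rightarrow> nat) \<Rightarrow> 'p \<Rightarrow> 'a ^ 'p" where
  "monom_vec l x \<alpha> i = Xpow l x \<alpha> *s axis i 1"

definition monomials :: "nat \<Rightarrow> (nat \<Rightarrow> 'a::ring_1) \<Rightarrow> ('a ^ 'p) set" where
  "monomials l x = {monom_vec l x \<alpha> i | \<alpha> i. \<alpha> \<in> expos l}"

definition right_divisible ::
    "nat \<Rightarrow> (nat \<Rightarrow> 'a::ring_1) \<Rightarrow> 'a ^ 'p \<Rightarrow> 'a ^ 'p \<Rightarrow> bool" where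
  "right_divisible l x u v \<longleftrightarrow>
     (\<exists>\<alpha>\<in>expos l. \<exists>\<beta>\<in>expos l. \<exists>i. u = monom_vec l x \<alpha> i \<and> v = monom_vec l x \<beta> i \<and>
        (\<forall>s<l. \<beta> s \<le> \<alpha> s))"

definition monom_index ::
    "nat \<Rightarrow> (nat \<Rightarrow> 'a::ring_1) \<Rightarrow> 'a ^ 'p \<Rightarrow> (nat \<Rightarrow> nat) \<times> 'p" where
  "monom_index l x = inv_into (expos l \<times> UNIV) (\<lambda>(\<alpha>, i). monom_vec l x \<alpha> i)"

definition lclm :: "nat \<Rightarrow> (nat \<Rightarrow> 'a::ring_1) \<Rightarrow> 'a ^ 'p \<Rightarrow> 'a ^ 'p \<Rightarrow> 'a ^ 'p" where
  "lclm l x u v =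
     (case (monom_index l x u, monom_index l x v) of
        ((\<alpha>, i), (\<beta>, j)) \<Rightarrow>
          if i = j then monom_vec l x (\<lambda>s. max (\<alpha> s) (\<beta> s)) i else 0)"

text \<open>
  Below, \<open>N\<close> is an \<open>R\<close>-basis of \<open>A\<^sup>p\<close> (always the set of monomials), and \<open>(v, u) \<in> le\<close>
  means \<open>v \<le> u\<close>. The terms \<open>lm\<close>, \<open>lc\<close> and \<open>lt\<close> are only meaningful for nonzero vectors.
\<close>

definition mcoeff :: "'a::ring_1 set \<Rightarrow> ('a ^ 'p) set \<Rightarrow> 'a ^ 'p \<Rightarrow> 'a ^ 'p \<Rightarrow> 'a" where
  "mcoeff R N f = coords vector_scalar_mult R N (\<lambda>u. u) f"

definition lm ::
    "'a::ring_1 set \<Rightarrow> ('a ^ 'p) set \<Rightarrow> ('a ^ 'p) rel \<Rightarrow> 'a ^ 'p \<Rightarrow> 'a ^ 'p" where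
  "lm R N le f =
     (THE u. u \<in> N \<and> mcoeff R N f u \<noteq> 0 \<and> (\<forall>v\<in>N. mcoeff R N f v \<noteq> 0 \<longrightarrow> (v, u) \<in> le))"

definition lc ::
    "'a::ring_1 set \<Rightarrow> ('a ^ 'p) set \<Rightarrow> ('a ^ 'p) rel \<Rightarrow> 'a ^ 'p \<Rightarrow> 'a" where
  "lc R N le f = mcoeff R N f (lm R N le f)"

definition lt ::
    "'a::ring_1 set \<Rightarrow> ('a ^ 'p) set \<Rightarrow> ('a ^ 'p) rel \<Rightarrow> 'a ^ 'p \<Rightarrow> 'a ^ 'p" where
  "lt R N le f = lc R N le f *s lm R N le f"

definition dd_monomial_ordering ::
    "'a::ring_1 set \<Rightarrow> ('a ^ 'p) set \<Rightarrow> ('a ^ 'p) rel \<Rightarrow> bool" where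
  "dd_monomial_ordering R N le \<longleftrightarrow>
     well_order_on N le \<and>
     (\<forall>u\<in>N. \<forall>v\<in>N. \<forall>f. f \<noteq> 0 \<and> (v, u) \<in> le - Id \<longrightarrow>
        (lm R N le (f *s v), lm R N le (f *s u)) \<in> le - Id)"


section \<open>Groebner-Shirshov bases\<close>

definition left_submodule :: "('a::ring_1 ^ 'p) set \<Rightarrow> bool" where
  "left_submodule M \<longleftrightarrow>
     0 \<in> M \<and> (\<forall>u\<in>M. \<forall>v\<in>M. u + v \<in> M) \<and> (\<forall>a. \<forall>u\<in>M. a *s u \<in> M)"

definition left_GS_basis ::
    "'a set \<Rightarrow> nat \<Rightarrow> (nat \<Rightarrow> 'a::ring_1) \<Rightarrow> ('a ^ 'p) rel \<Rightarrow> ('a ^ 'p) set \<Rightarrow> ('a ^ 'p) set \<Rightarrow> bool" where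
  "left_GS_basis R l x le M G \<longleftrightarrow>
     G \<subseteq> M \<and> 0 \<notin> G \<and>
     (\<forall>f\<in>M. f \<noteq> 0 \<longrightarrow>
        (\<exists>g\<in>G. right_divisible l x (lm R (monomials l x) le f) (lm R (monomials l x) le g)))"

definition left_quotient :: "'a::ring_1 ^ 'p \<Rightarrow> 'a ^ 'p \<Rightarrow> 'a" where
  "left_quotient w t = (THE a. a *s t = w)"

definition Svect ::
    "'a set \<Rightarrow> nat \<Rightarrow> (nat \<Rightarrow> 'a::ring_1) \<Rightarrow> ('a ^ 'p) rel \<Rightarrow> 'a ^ 'p \<Rightarrow> 'a ^ 'p \<Rightarrow> 'a ^ 'p" where
  "Svect R l x le f g =
     (let N = monomials l x; w = lclm l x (lm R N le f) (lm R N le g)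
      in left_quotient w (lt R N le f) *s f - left_quotient w (lt R N le g) *s g)"

definition reduces_to_0 ::
    "'a::ring_1 set \<Rightarrow> ('a ^ 'p) set \<Rightarrow> ('a ^ 'p) rel \<Rightarrow> ('a ^ 'p) set \<Rightarrow> 'a ^ 'p \<Rightarrow> bool" where
  "reduces_to_0 R N le G f \<longleftrightarrow>
     f = 0 \<or>
     (\<exists>(q::nat) a g. (\<forall>i<q. g i \<in> G) \<and> f = (\<Sum>i<q. a i *s g i) \<and>
        (\<forall>i<q. a i *s g i \<noteq> 0 \<longrightarrow> (lm R N le (a i *s g i), lm R N le f) \<in> le))"

end

theory Submission
  imports Defs
begin

text \<open>
  The ideas are those of Buchberger's criterion. If every element of \<open>M\<close> has a leading monomial
  divisible by some \<open>lm g\<close>, then division by \<open>G\<close> terminates with remainder zero, in particular for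
  S-vectors (\<open>GS_basis_rep\<close>). Conversely, let \<open>f \<noteq> 0\<close> be a sum of vectors \<open>a *s g\<close> with \<open>g \<in> G\<close>,
  and let \<open>w\<close> be the largest monomial of these summands. Modulo vectors below \<open>w\<close>, each summand
  that reaches \<open>w\<close> is a scalar multiple of some \<open>b *s g\<close> with \<open>b *s lt g = w\<close>. For two such vectors,
  \<open>b *s g - b' *s g'\<close> is a left multiple of the S-vector of \<open>g\<close> and \<open>g'\<close> (\<open>equal_lterm_diff\<close>); if the
  S-vector reduces to zero, this difference is a sum of multiples of \<open>G\<close> below \<open>w\<close>. Hence all
  summands at \<open>w\<close> can be merged into a single one (\<open>rep_merge_top\<close>). If its scalar is nonzero, then
  \<open>w\<close> is the leading monomial of \<open>f\<close> and is divisible by \<open>lm g\<close>; otherwise \<open>w\<close> can be lowered, and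
  the ordering is well-founded.

  The algebra is not commutative, and the product of two monomials need not have the expected
  leading monomial: if \<open>\<sigma>\<close> exchanges two of the \<open>D\<close>s, then \<open>D\<^sub>1 S = S D\<^sub>2\<close>. The argument
  survives because it rests on four weaker properties of a monomial \<open>u\<close> and an algebra element \<open>a\<close>,
  which are the assumptions of the locale \<open>monomial_module\<close> below:

  \<^item> all monomials in \<open>a *s u\<close> are divisible by \<open>u\<close>: pushing a \<open>D j\<close> to the right through powers of
    the \<open>S i\<close> turns it into an \<open>R\<close>-combination of the \<open>D s\<close> (\<open>D_mult_X\<close>);
  \<^item> every monomial divisible by \<open>u\<close> is a left multiple of \<open>u\<close>: the powers of the \<open>S i\<close> can be moved
    to the right past the \<open>D j\<close>, since the \<open>\<sigma> i\<close> are surjective (\<open>X_multiple\<close>);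
  \<^item> \<open>a *s u = 0\<close> only if \<open>a = 0\<close>, which the strictness of the ordering enforces (\<open>cancel_mon\<close>);
  \<^item> for a scalar \<open>c \<noteq> 0\<close>, the vectors \<open>a *s (c *s u)\<close> and \<open>a *s u\<close> contain the same monomials
    (\<open>support_rescale_mon\<close>).

  The last property is what makes \<open>lm (a *s f) = lm (a *s lm f)\<close>: multiplying by \<open>a\<close> treats the
  terms of \<open>f\<close> like the bare monomials, to which the ordering condition applies. It is here that the
  field \<open>R\<close> matters. In characteristic zero a finite extension of \<open>k\<close> has no nonzero derivations
  (\<open>derivation_eq_zero\<close>), so scalars commute with the \<open>D j\<close> and are only twisted by the \<open>S i\<close>. A
  nonzero scalar to the left of a monomial can therefore be moved to its right end, where it merely
  multiplies each coefficient of a vector by a nonzero scalar.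
\<close>

section \<open>Coordinates in a free left module\<close>

text \<open>
  The action \<open>act\<close> is by the whole ring, while coordinates are taken in the subring \<open>R\<close>. This
  covers both the algebra over \<open>R\<close> and the free module over the algebra.
\<close>

locale free_left_module =
  fixes act :: "'r::ring_1 \<Rightarrow> 'v::ab_group_add \<Rightarrow> 'v"
    and R :: "'r set" and I :: "'i set" and b :: "'i \<Rightarrow> 'v"
  assumes basis: "left_basis act R I b"
    and one_R: "1 \<in> R"
    and add_R: "x \<in> R \<Longrightarrow> y \<in> R \<Longrightarrow> x + y \<in> R"
    and neg_R: "x \<in> R \<Longrightarrow> - x \<in> R"
    and mult_R: "x \<in> R \<Longrightarrow> y \<in> R \<Longrightarrow> x * y \<in> R"
    and act_one: "act 1 v = v"
    and act_add: "act (x + y) v = act x v + act y v"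
    and act_mult: "act (x * y) v = act x (act y v)"
    and act_add_right: "act x (v + w) = act x v + act x w"
begin

abbreviation coef :: "'v \<Rightarrow> 'i \<Rightarrow> 'r" where
  "coef v \<equiv> coords act R I b v"

lemma zero_R: "0 \<in> R"
  using add_R[OF one_R neg_R[OF one_R]] by simp

lemma act_zero: "act 0 v = 0"
  using act_add[of 0 0 v] by simp

lemma act_zero_right: "act x 0 = 0"
  using act_add_right[of x 0 0] by simp

lemma act_minus: "act (- x) v = - act x v"
  by (rule minus_unique[symmetric]) (simp add: act_zero flip: act_add)

lemma act_sum_right: "act x (sum f F) = (\<Sum>i\<in>F. act x (f i))"
  by (induction F rule: infinite_finite_induct) (simp_all add: act_zero_right act_add_right)

lemma lin_comb_superset:
  assumes "finite F" "{i. c i \<noteq> 0} \<subseteq> F"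
  shows "lin_comb act b c = (\<Sum>i\<in>F. act (c i) (b i))"
  unfolding lin_comb_def
  by (rule sum.mono_neutral_left) (use assms act_zero in auto)

lemma coef_spec: "coeff_family R I (coef v)" "v = lin_comb act b (coef v)"
proof -
  have "\<exists>!c. coeff_family R I c \<and> v = lin_comb act b c"
    using basis unfolding left_basis_def by blast
  from theI'[OF this] show "coeff_family R I (coef v)" "v = lin_comb act b (coef v)"
    unfolding coords_def by blast+
qed

lemma coef_eqI:
  assumes "coeff_family R I c" "v = lin_comb act b c"
  shows "coef v = c"
proof -
  have "\<exists>!c. coeff_family R I c \<and> v = lin_comb act b c"
    using basis unfolding left_basis_def by blast
  then show ?thesis
    using assms coef_spec[of v] by blast
qed

lemma coef_in_R: "coef v i \<in> R"
  and finite_support: "finite {i. coef v i \<noteq> 0}"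
  and support_subset: "coef v i \<noteq> 0 \<Longrightarrow> i \<in> I"
  using coef_spec(1)[of v] unfolding coeff_family_def by auto

lemma expansion: "v = (\<Sum>i | coef v i \<noteq> 0. act (coef v i) (b i))"
  using coef_spec(2)[of v] unfolding lin_comb_def .

lemma coef_add: "coef (v + w) i = coef v i + coef w i"
proof -
  let ?F = "{i. coef v i \<noteq> 0} \<union> {i. coef w i \<noteq> 0}"
  have F: "finite ?F" by (simp add: finite_support)
  have "{i. coef v i + coef w i \<noteq> 0} \<subseteq> ?F" by auto
  then have "coeff_family R I (\<lambda>i. coef v i + coef w i)"
    unfolding coeff_family_def
    using F finite_subset support_subset by (auto intro: add_R coef_in_R)
  moreover have "v + w = lin_comb act b (\<lambda>i. coef v i + coef w i)"
  proof -
    have "v = (\<Sum>i\<in>?F. act (coef v i) (b i))" "w = (\<Sum>i\<in>?F. act (coef w i) (b i))"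
      using coef_spec(2) lin_comb_superset[OF F, of "coef v"] lin_comb_superset[OF F, of "coef w"]
      by simp_all
    moreover have "lin_comb act b (\<lambda>i. coef v i + coef w i)
        = (\<Sum>i\<in>?F. act (coef v i + coef w i) (b i))"
      by (rule lin_comb_superset[OF F]) auto
    ultimately show ?thesis by (simp add: act_add sum.distrib)
  qed
  ultimately show ?thesis using coef_eqI by metis
qed

lemma coef_scale:
  assumes "r \<in> R"
  shows "coef (act r v) i = r * coef v i"
proof -
  let ?F = "{i. coef v i \<noteq> 0}"
  have sub: "{i. r * coef v i \<noteq> 0} \<subseteq> ?F" by auto
  then have "coeff_family R I (\<lambda>i. r * coef v i)"
    unfolding coeff_family_def
    using finite_support finite_subset support_subset by (auto intro: mult_R coef_in_R assms)
  moreover have "act r v = lin_comb act b (\<lambda>i. r * coef v i)"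
    using expansion[of v]
    by (simp add: lin_comb_superset[OF finite_support sub] act_mult flip: act_sum_right)
  ultimately show ?thesis using coef_eqI by metis
qed

lemma coef_zero: "coef 0 i = 0"
  using coef_add[of 0 0 i] by simp

lemma coef_minus: "coef (- v) i = - coef v i"
  by (rule minus_unique[symmetric]) (simp add: coef_zero flip: coef_add)

lemma coef_diff: "coef (v - w) i = coef v i - coef w i"
  using coef_add[of v "- w" i] by (simp add: coef_minus)

lemma coef_sum: "coef (sum f F) i = (\<Sum>j\<in>F. coef (f j) i)"
  by (induction F rule: infinite_finite_induct) (simp_all add: coef_zero coef_add)

lemma coef_basis:
  assumes "j \<in> I"
  shows "coef (b j) i = (if i = j then 1 else 0)"
proof -
  let ?c = "\<lambda>i. if i = j then 1 else 0 :: 'r"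
  have "{i. ?c i \<noteq> 0} = {j}" by auto
  then have "coeff_family R I ?c" "b j = lin_comb act b ?c"
    using assms one_R zero_R by (auto simp: coeff_family_def lin_comb_def act_one)
  then show ?thesis using coef_eqI[of ?c "b j"] by simp
qed

lemma zero_iff_coef: "v = 0 \<longleftrightarrow> (\<forall>i. coef v i = 0)"
proof
  assume *: "\<forall>i. coef v i = 0"
  show "v = 0" using expansion[of v] * by simp
qed (simp add: coef_zero)

lemma inj_on_basis: "inj_on b I"
proof (rule inj_onI)
  fix i j assume ij: "i \<in> I" "j \<in> I" "b i = b j"
  show "i = j" using coef_basis[OF ij(1), of i] coef_basis[OF ij(2), of i] ij(3)
    by (auto split: if_splits)
qed

text \<open>
  A basis indexed by exponents becomes one indexed by its own vectors, which is how monomials are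
  used as basis of the free module.
\<close>

lemma left_basis_image: "left_basis act R (b ` I) (\<lambda>u. u)"
  unfolding left_basis_def
proof (intro allI ex_ex1I)
  fix v
  let ?c = "\<lambda>u. if u \<in> b ` I then coef v (inv_into I b u) else 0"
  have supp: "{u. ?c u \<noteq> 0} = b ` {i. coef v i \<noteq> 0}"
    using support_subset inv_into_f_f[OF inj_on_basis] by (auto simp: image_iff) metis
  have inj: "inj_on b {i. coef v i \<noteq> 0}"
    using inj_on_basis support_subset by (auto intro: inj_on_subset)
  have "lin_comb act (\<lambda>u. u) ?c = (\<Sum>i | coef v i \<noteq> 0. act (?c (b i)) (b i))"
    unfolding lin_comb_def supp sum.reindex[OF inj] by simp
  also have "\<dots> = (\<Sum>i | coef v i \<noteq> 0. act (coef v i) (b i))"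
    using support_subset inv_into_f_f[OF inj_on_basis] by (intro sum.cong) auto
  finally have "v = lin_comb act (\<lambda>u. u) ?c" using expansion[of v] by simp
  moreover have "coeff_family R (b ` I) ?c"
    unfolding coeff_family_def supp
    using support_subset by (auto intro: coef_in_R zero_R finite_support)
  ultimately show "\<exists>c. coeff_family R (b ` I) c \<and> v = lin_comb act (\<lambda>u. u) c" by blast
next
  fix v c d
  have pull: "coef v = (\<lambda>i. if i \<in> I then c (b i) else 0)"
    if c: "coeff_family R (b ` I) c" "v = lin_comb act (\<lambda>u. u) c" for c
  proof (rule coef_eqI)
    let ?e = "\<lambda>i. if i \<in> I then c (b i) else 0"
    have supp: "{u. c u \<noteq> 0} = b ` {i. ?e i \<noteq> 0}"
      using c(1) by (auto simp: coeff_family_def)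
    have inj: "inj_on b {i. ?e i \<noteq> 0}"
      by (rule inj_on_subset[OF inj_on_basis]) auto
    have "finite {i. ?e i \<noteq> 0}"
      using c(1) finite_image_iff[OF inj] supp by (simp add: coeff_family_def)
    then show "coeff_family R I ?e"
      using c(1) zero_R by (auto simp: coeff_family_def)
    have "lin_comb act (\<lambda>u. u) c = (\<Sum>i | ?e i \<noteq> 0. act (c (b i)) (b i))"
      unfolding lin_comb_def supp sum.reindex[OF inj] by simp
    also have "\<dots> = lin_comb act b ?e"
      unfolding lin_comb_def by (intro sum.cong) auto
    finally show "v = lin_comb act b ?e" using c(2) by simp
  qed
  assume c: "coeff_family R (b ` I) c \<and> v = lin_comb act (\<lambda>u. u) c"
    and d: "coeff_family R (b ` I) d \<and> v = lin_comb act (\<lambda>u. u) d"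
  show "c = d"
  proof
    fix u
    show "c u = d u"
    proof (cases "u \<in> b ` I")
      case True
      then obtain i where i: "i \<in> I" "u = b i" by blast
      have "c (b i) = coef v i" "d (b i) = coef v i"
        using fun_cong[OF pull[OF conjunct1[OF c] conjunct2[OF c]], of i]
          fun_cong[OF pull[OF conjunct1[OF d] conjunct2[OF d]], of i] i(1) by simp_all
      then show ?thesis using i by simp
    next
      case False
      then have "c u = 0" "d u = 0"
        using conjunct1[OF c] conjunct1[OF d] by (auto simp: coeff_family_def)
      then show ?thesis by simp
    qed
  qed
qed

end

text \<open>An expansion of a vector is a separate expansion of each of its components.\<close>

lemma left_basis_vec:
  fixes b :: "'i \<Rightarrow> 'a::ring_1" and R :: "'a set"
  assumes "free_left_module (*) R I b"
  shows "left_basis (*s) R (I \<times> (UNIV :: 'p::finite set)) (\<lambda>(i, k). b i *s axis k (1 :: 'a))"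
proof -
  interpret free_left_module "(*)" R I b by fact
  let ?b = "\<lambda>(i, k :: 'p). b i *s axis k (1 :: 'a)"
  have comp: "lin_comb (*s) ?b c $ k = lin_comb (*) b (\<lambda>i. c (i, k))"
    if "finite {z. c z \<noteq> 0}" for c :: "'i \<times> 'p \<Rightarrow> 'a" and k
  proof -
    let ?F = "fst ` {z. c z \<noteq> 0}"
    have F: "finite ?F" using that by simp
    have "lin_comb (*s) ?b c = (\<Sum>z\<in>?F \<times> UNIV. c z *s ?b z)"
      unfolding lin_comb_def
    proof (rule sum.mono_neutral_left)
      show "finite (?F \<times> (UNIV :: 'p set))" using F by simp
      show "{z. c z \<noteq> 0} \<subseteq> ?F \<times> UNIV" by force
    qed auto
    then have "lin_comb (*s) ?b c $ k
        = (\<Sum>(i, j)\<in>?F \<times> UNIV. c (i, j) * (b i * axis j 1 $ k))"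
      by (simp add: case_prod_unfold)
    also have "\<dots> = (\<Sum>i\<in>?F. \<Sum>j\<in>UNIV. c (i, j) * (b i * axis j 1 $ k))"
      by (rule sum.cartesian_product[symmetric])
    also have "\<dots> = (\<Sum>i\<in>?F. c (i, k) * b i)"
      by (intro sum.cong refl, subst sum.remove[of _ k]) (auto simp: axis_def)
    also have "\<dots> = lin_comb (*) b (\<lambda>i. c (i, k))"
      by (rule lin_comb_superset[OF F, symmetric]) force
    finally show ?thesis .
  qed
  show ?thesis
    unfolding left_basis_def
  proof (intro allI ex_ex1I)
    fix v :: "'a ^ 'p"
    let ?c = "\<lambda>(i, k). coef (v $ k) i"
    have "{z. ?c z \<noteq> 0} \<subseteq> (\<Union>k. {i. coef (v $ k) i \<noteq> 0} \<times> {k})" by auto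
    then have fin: "finite {z. ?c z \<noteq> 0}"
      by (rule finite_subset) (simp add: finite_support)
    then have "coeff_family R (I \<times> UNIV) ?c"
      using support_subset by (auto simp: coeff_family_def intro: coef_in_R)
    moreover have "v = lin_comb (*s) ?b ?c"
      using coef_spec(2) by (simp add: vec_eq_iff comp[OF fin])
    ultimately show "\<exists>c. coeff_family R (I \<times> UNIV) c \<and> v = lin_comb (*s) ?b c" by blast
  next
    fix v :: "'a ^ 'p" and c d
    have pull: "coef (v $ k) i = c (i, k)"
      if c: "coeff_family R (I \<times> UNIV) c" "v = lin_comb (*s) ?b c" for c k i
    proof -
      have fin: "finite {z. c z \<noteq> 0}" using c(1) by (simp add: coeff_family_def)
      have "finite (fst ` {z. c z \<noteq> 0})" using fin by simp
      moreover have "{i. c (i, k) \<noteq> 0} \<subseteq> fst ` {z. c z \<noteq> 0}" by force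
      ultimately have "finite {i. c (i, k) \<noteq> 0}" by (rule finite_subset[rotated])
      then have "coeff_family R I (\<lambda>i. c (i, k))"
        using c(1) by (auto simp: coeff_family_def)
      then show ?thesis
        using coef_eqI[of "\<lambda>i. c (i, k)" "v $ k"] comp[OF fin, of k] c(2) by simp
    qed
    assume c: "coeff_family R (I \<times> UNIV) c \<and> v = lin_comb (*s) ?b c"
      and d: "coeff_family R (I \<times> UNIV) d \<and> v = lin_comb (*s) ?b d"
    have "c (i, k) = d (i, k)" for i k
      using pull[OF conjunct1[OF c] conjunct2[OF c], of k i]
        pull[OF conjunct1[OF d] conjunct2[OF d], of k i] by simp
    then show "c = d" by auto
  qed
qed


section \<open>Leading monomials and products\<close>

text \<open>
  The properties of monomials on which the criterion depends. Products of two monomials do not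
  occur in them, only the monomials contained in \<open>a *s u\<close>. Divisibility is also an
  abstract relation, tied to \<open>a *s u\<close> from both sides: what occurs in \<open>a *s u\<close> is divisible by \<open>u\<close>,
  and what is divisible by \<open>u\<close> has the form \<open>h *s u\<close>.
\<close>

locale monomial_module = free_left_module "(*s)" R N "\<lambda>u. u"
  for R :: "'a::ring_1 set" and N :: "('a ^ 'p::finite) set" +
  fixes le :: "('a ^ 'p) rel"
    and multiple :: "'a ^ 'p \<Rightarrow> 'a ^ 'p \<Rightarrow> bool"
    and lcmul :: "'a ^ 'p \<Rightarrow> 'a ^ 'p \<Rightarrow> 'a ^ 'p"
  assumes ordering: "dd_monomial_ordering R N le"
    and inverse_R: "c \<in> R \<Longrightarrow> c \<noteq> 0 \<Longrightarrow> \<exists>d\<in>R. d * c = 1"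
    and support_rescale: "u \<in> N \<Longrightarrow> c \<in> R \<Longrightarrow> c \<noteq> 0 \<Longrightarrow>
      mcoeff R N (a *s (c *s u)) v \<noteq> 0 \<longleftrightarrow> mcoeff R N (a *s u) v \<noteq> 0"
    and support_multiple: "u \<in> N \<Longrightarrow> mcoeff R N (a *s u) v \<noteq> 0 \<Longrightarrow> multiple v u"
    and multiple_in: "multiple w u \<Longrightarrow> w \<in> N" "multiple w u \<Longrightarrow> u \<in> N"
    and multiple_quotient: "multiple w u \<Longrightarrow> \<exists>h. h *s u = w"
    and cancel: "u \<in> N \<Longrightarrow> a *s u = 0 \<Longrightarrow> a = 0"
    and lcmul: "multiple w u \<Longrightarrow> multiple w v \<Longrightarrow>
      multiple (lcmul u v) u \<and> multiple (lcmul u v) v \<and> multiple w (lcmul u v)"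
begin

definition supp :: "'a ^ 'p \<Rightarrow> ('a ^ 'p) set" where
  "supp f = {u. mcoeff R N f u \<noteq> 0}"

definition below :: "'a ^ 'p \<Rightarrow> ('a ^ 'p) set" where
  "below w = {u. (u, w) \<in> le - Id}"

definition at_most :: "'a ^ 'p \<Rightarrow> ('a ^ 'p) set" where
  "at_most w = {u. (u, w) \<in> le}"

abbreviation lead :: "'a ^ 'p \<Rightarrow> 'a ^ 'p" where "lead \<equiv> lm R N le"
abbreviation lterm :: "'a ^ 'p \<Rightarrow> 'a ^ 'p" where "lterm \<equiv> lt R N le"

lemma supp_coef: "supp f = {u. coef f u \<noteq> 0}"
  by (simp add: supp_def mcoeff_def)

lemma supp_subset: "supp f \<subseteq> N"
  using support_subset by (auto simp: supp_coef)

lemma finite_supp: "finite (supp f)"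
  by (simp add: supp_coef finite_support)

lemma supp_eq_empty: "supp f = {} \<longleftrightarrow> f = 0"
  using zero_iff_coef[of f] by (auto simp: supp_coef)

lemma supp_zero: "supp 0 = {}"
  by (simp add: supp_eq_empty)

lemma supp_add: "supp (f + g) \<subseteq> supp f \<union> supp g"
  by (auto simp: supp_coef coef_add)

lemma supp_diff: "supp (f - g) \<subseteq> supp f \<union> supp g"
  by (auto simp: supp_coef coef_diff)

lemma supp_diff_subset: "supp f \<subseteq> K \<Longrightarrow> supp g \<subseteq> K \<Longrightarrow> supp (f - g) \<subseteq> K"
  using supp_diff[of f g] by blast

lemma supp_scale: "r \<in> R \<Longrightarrow> supp (r *s f) \<subseteq> supp f"
  by (auto simp: supp_coef coef_scale)

lemma supp_monomial: "u \<in> N \<Longrightarrow> supp u = {u}"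
  by (auto simp: supp_coef coef_basis)

lemma supp_sum: "supp (sum f F) \<subseteq> (\<Union>i\<in>F. supp (f i))"
proof (induction F rule: infinite_finite_induct)
  case (insert x F)
  then show ?case using supp_add[of "f x" "sum f F"] by auto
qed (simp_all add: supp_zero)

lemma supp_rescale: "u \<in> N \<Longrightarrow> c \<in> R \<Longrightarrow> c \<noteq> 0 \<Longrightarrow> supp (a *s (c *s u)) = supp (a *s u)"
  by (simp add: supp_def support_rescale)

lemma well_order: "well_order_on N le"
  using ordering by (simp add: dd_monomial_ordering_def)

lemma le_in_N: "(u, v) \<in> le \<Longrightarrow> u \<in> N" "(u, v) \<in> le \<Longrightarrow> v \<in> N"
  and le_refl: "u \<in> N \<Longrightarrow> (u, u) \<in> le"
  and le_trans: "(u, v) \<in> le \<Longrightarrow> (v, w) \<in> le \<Longrightarrow> (u, w) \<in> le"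
  and le_antisym: "(u, v) \<in> le \<Longrightarrow> (v, u) \<in> le \<Longrightarrow> u = v"
  and le_total: "u \<in> N \<Longrightarrow> v \<in> N \<Longrightarrow> (u, v) \<in> le \<or> (v, u) \<in> le"
  and wf_less: "wf (le - Id)"
proof -
  have r: "le \<subseteq> N \<times> N" "refl_on N le" "trans le" "antisym le" "total_on N le" "wf (le - Id)"
    using well_order by (auto simp: order_on_defs)
  show "(u, v) \<in> le \<Longrightarrow> u \<in> N" "(u, v) \<in> le \<Longrightarrow> v \<in> N" using r(1) by auto
  show refl: "u \<in> N \<Longrightarrow> (u, u) \<in> le" using r(2) by (rule refl_onD)
  show "(u, v) \<in> le \<Longrightarrow> (v, w) \<in> le \<Longrightarrow> (u, w) \<in> le" using r(3) by (rule transD)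
  show "(u, v) \<in> le \<Longrightarrow> (v, u) \<in> le \<Longrightarrow> u = v" using r(4) by (rule antisymD)
  show "u \<in> N \<Longrightarrow> v \<in> N \<Longrightarrow> (u, v) \<in> le \<or> (v, u) \<in> le"
    using refl r(5) by (cases "u = v") (auto simp: total_on_def)
  show "wf (le - Id)" by (rule r(6))
qed

lemma below_subset_at_most: "below w \<subseteq> at_most w"
  by (auto simp: below_def at_most_def)

lemma at_most_subset_below: "w \<in> below v \<Longrightarrow> at_most w \<subseteq> below v"
  unfolding below_def at_most_def using le_trans le_antisym by blast

lemma at_most_below: "w \<in> N \<Longrightarrow> at_most w = insert w (below w)"
  unfolding below_def at_most_def using le_refl by auto

lemma lead_eqI: "w \<in> supp f \<Longrightarrow> supp f \<subseteq> at_most w \<Longrightarrow> lead f = w"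
  unfolding lm_def
  by (rule the_equality)
    (use supp_subset[of f] le_antisym in \<open>auto simp: supp_def at_most_def subset_iff\<close>)

lemma finite_has_max:
  assumes "finite F" "F \<noteq> {}" "F \<subseteq> N"
  shows "\<exists>w\<in>F. F \<subseteq> at_most w"
  using assms
proof (induction F rule: finite_ne_induct)
  case (singleton x)
  then show ?case using le_refl by (auto simp: at_most_def)
next
  case (insert x F)
  then obtain w where w: "w \<in> F" "F \<subseteq> at_most w" by auto
  then have "(x, w) \<in> le \<or> (w, x) \<in> le" using insert.prems le_total by blast
  moreover have "at_most w \<subseteq> at_most x" if "(w, x) \<in> le"
    using that le_trans by (auto simp: at_most_def)
  moreover have "x \<in> at_most x" using insert.prems le_refl by (simp add: at_most_def)
  ultimately show ?case using w by (auto simp: at_most_def)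
qed

lemma lead:
  assumes "f \<noteq> 0"
  shows "lead f \<in> supp f" "supp f \<subseteq> at_most (lead f)" "lead f \<in> N"
proof -
  obtain w where "w \<in> supp f" "supp f \<subseteq> at_most w"
    using finite_has_max[OF finite_supp, of f] supp_subset assms supp_eq_empty by blast
  then show "lead f \<in> supp f" "supp f \<subseteq> at_most (lead f)" "lead f \<in> N"
    using lead_eqI[of w f] supp_subset by auto
qed

lemma lead_less:
  "u \<in> N \<Longrightarrow> v \<in> below u \<Longrightarrow> e \<noteq> 0 \<Longrightarrow> lead (e *s v) \<in> below (lead (e *s u))"
  using ordering le_in_N unfolding dd_monomial_ordering_def below_def by auto

text \<open>
  The terms \<open>c *s u\<close> of \<open>f\<close> contribute to \<open>e *s f\<close> the same monomials as \<open>e *s u\<close>, so the ordering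
  condition, which concerns monomials, passes to vectors.
\<close>

lemma supp_mult_below:
  assumes "e \<noteq> 0" "w \<in> N" "supp f \<subseteq> below w"
  shows "supp (e *s f) \<subseteq> below (lead (e *s w))"
proof -
  have "supp (e *s (coef f u *s u)) \<subseteq> below (lead (e *s w))" if u: "u \<in> supp f" for u
  proof -
    have uN: "u \<in> N" and c: "coef f u \<noteq> 0" using u supp_subset by (auto simp: supp_coef)
    have "e *s u \<noteq> 0" using cancel uN assms(1) by blast
    then have "supp (e *s u) \<subseteq> at_most (lead (e *s u))" using lead by blast
    also have "\<dots> \<subseteq> below (lead (e *s w))"
      using at_most_subset_below lead_less assms u by blast
    finally show ?thesis using supp_rescale[OF uN coef_in_R c] by simp
  qed
  moreover have "e *s f = (\<Sum>u\<in>supp f. e *s (coef f u *s u))"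
    using arg_cong[OF expansion[of f], of "(*s) e"] unfolding supp_coef act_sum_right .
  ultimately show ?thesis
    using order_trans[OF supp_sum UN_least, of "supp f" "\<lambda>u. e *s (coef f u *s u)"] by simp
qed

lemma lterm:
  assumes "f \<noteq> 0"
  shows "lterm f = lc R N le f *s lead f" "lc R N le f \<in> R" "lc R N le f \<noteq> 0"
    "supp (f - lterm f) \<subseteq> below (lead f)"
proof -
  have c: "lc R N le f = coef f (lead f)" by (simp add: lc_def mcoeff_def)
  show "lterm f = lc R N le f *s lead f" by (simp add: lt_def)
  show "lc R N le f \<in> R" by (simp add: c coef_in_R)
  show "lc R N le f \<noteq> 0" using lead(1)[OF assms] by (simp add: c supp_coef)
  have "coef (f - lterm f) u = (if u = lead f then 0 else coef f u)" for u
    using lead(3)[OF assms]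
    by (simp add: lt_def c coef_diff coef_scale coef_basis coef_in_R)
  then show "supp (f - lterm f) \<subseteq> below (lead f)"
    using lead(2)[OF assms] by (auto simp: supp_coef below_def at_most_def split: if_splits)
qed

text \<open>Left quotients by a leading term are unique because leading coefficients are invertible.\<close>

lemma cancel_lterm: "g \<noteq> 0 \<Longrightarrow> a *s lterm g = b *s lterm g \<Longrightarrow> a = b"
proof -
  assume g: "g \<noteq> 0" and eq: "a *s lterm g = b *s lterm g"
  have "((a - b) * lc R N le g) *s lead g = 0"
    using eq by (simp add: lterm(1)[OF g] vec_eq_iff algebra_simps)
  then have "(a - b) * lc R N le g = 0" using cancel lead(3)[OF g] by blast
  moreover have "\<exists>d\<in>R. lc R N le g * d = 1"
  proof -
    obtain d where d: "d \<in> R" "d * lc R N le g = 1" using inverse_R lterm(2,3)[OF g] by blast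
    then have "d \<noteq> 0" by auto
    then obtain e where "e * d = 1" using inverse_R d by blast
    then have "e = lc R N le g"
      using d(2) mult.assoc[of e d "lc R N le g"] by simp
    then show ?thesis using d \<open>e * d = 1\<close> by blast
  qed
  ultimately have "a - b = 0"
    using mult.assoc[of "a - b" "lc R N le g"] by (metis mult_1_right mult_zero_left)
  then show ?thesis by simp
qed

lemma lterm_quotient:
  assumes "g \<noteq> 0" "multiple w (lead g)"
  shows "\<exists>h. h *s lterm g = w"
proof -
  obtain h where h: "h *s lead g = w" using multiple_quotient assms by blast
  obtain d where "d * lc R N le g = 1" using inverse_R lterm(2,3)[OF assms(1)] by blast
  then have "(h * d) *s lterm g = w"
    using h by (simp add: lterm(1)[OF assms(1)] mult.assoc flip: act_mult)
  then show ?thesis by blast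
qed

lemma left_quotient_lterm:
  assumes "g \<noteq> 0" "multiple w (lead g)"
  shows "left_quotient w (lterm g) *s lterm g = w"
  unfolding left_quotient_def
  by (rule theI') (use lterm_quotient[OF assms] cancel_lterm[OF assms(1)] in blast)

text \<open>
  The lower terms of \<open>g\<close> stay below \<open>lead (a *s lead g)\<close> after multiplication by \<open>a\<close>, and the leading
  term contributes the monomials of \<open>a *s lead g\<close>.
\<close>

lemma lead_mult:
  assumes "a \<noteq> 0" "g \<noteq> 0"
  shows "supp (a *s g) \<subseteq> at_most (lead (a *s lead g))" "lead (a *s lead g) \<in> supp (a *s g)"
    "multiple (lead (a *s lead g)) (lead g)"
    "supp (a *s g - a *s lterm g) \<subseteq> below (lead (a *s lead g))"
proof -
  let ?w = "lead (a *s lead g)"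
  have nz: "a *s lead g \<noteq> 0" using cancel lead(3) assms by blast
  show mult: "multiple ?w (lead g)"
    using support_multiple[of "lead g" a] lead(3)[OF assms(2)] lead(1)[OF nz]
    by (simp add: supp_def)
  have "supp (a *s (g - lterm g)) \<subseteq> below ?w"
    using supp_mult_below lterm(4) lead(3) assms by blast
  moreover have split: "a *s (g - lterm g) = a *s g - a *s lterm g"
    by (simp add: vec_eq_iff algebra_simps)
  ultimately show rest: "supp (a *s g - a *s lterm g) \<subseteq> below ?w" by simp
  have top: "supp (a *s lterm g) = supp (a *s lead g)"
    using supp_rescale lterm assms(2) lead(3) by simp
  have "a *s g = (a *s g - a *s lterm g) + a *s lterm g" by simp
  then have "supp (a *s g) \<subseteq> supp (a *s g - a *s lterm g) \<union> supp (a *s lterm g)"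
    using supp_add by metis
  then show "supp (a *s g) \<subseteq> at_most ?w"
    using rest top lead(2)[OF nz] below_subset_at_most[of ?w] by blast
  have "coef (a *s g - a *s lterm g) ?w = 0"
    using rest by (auto simp: supp_coef below_def)
  then have "coef (a *s g) ?w = coef (a *s lterm g) ?w" by (simp add: coef_diff)
  then show "?w \<in> supp (a *s g)"
    using lead(1)[OF nz] unfolding top[symmetric] by (simp add: supp_coef)
qed

lemma lead_of_mult:
  assumes "a *s g \<noteq> 0" "g \<noteq> 0"
  shows "multiple (lead (a *s g)) (lead g)"
proof -
  have "a \<noteq> 0" using assms(1) act_zero by blast
  note m = lead_mult[OF this assms(2)]
  show ?thesis using m(3) lead_eqI[OF m(2,1)] by simp
qed

lemma quotient_remainder:
  assumes "g \<noteq> 0" "a *s lterm g = w" "w \<in> N"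
  shows "supp (a *s g - w) \<subseteq> below w"
proof -
  have "supp (a *s lead g) = {w}"
    using supp_rescale[OF lead(3)[OF assms(1)] lterm(2,3)[OF assms(1)], of a]
      supp_monomial[OF assms(3)] by (simp add: assms(2) flip: lterm(1)[OF assms(1)])
  moreover from this have nz: "a *s lead g \<noteq> 0" using supp_eq_empty by auto
  ultimately have "lead (a *s lead g) = w" using lead(1) by blast
  moreover have "a \<noteq> 0" using nz act_zero by blast
  ultimately show ?thesis using lead_mult(4)[of a g] assms by simp
qed

section \<open>Sums of multiples with bounded monomials\<close>

text \<open>
  The vectors that are sums of multiples of elements of \<open>G\<close> such that every summand uses only
  monomials in \<open>K\<close>, even before cancellation.
\<close>

inductive_set rep :: "('a ^ 'p) set \<Rightarrow> ('a ^ 'p) set \<Rightarrow> ('a ^ 'p) set"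
  for G K where
  rep_zero: "0 \<in> rep G K"
| rep_step: "f \<in> rep G K \<Longrightarrow> g \<in> G \<Longrightarrow> supp (a *s g) \<subseteq> K \<Longrightarrow> a *s g + f \<in> rep G K"

lemma rep_single: "g \<in> G \<Longrightarrow> supp (a *s g) \<subseteq> K \<Longrightarrow> a *s g \<in> rep G K"
  using rep_step[OF rep_zero, of g] by simp

lemma rep_add: "f \<in> rep G K \<Longrightarrow> h \<in> rep G K \<Longrightarrow> f + h \<in> rep G K"
  by (induction rule: rep.induct) (auto intro: rep_step simp: add.assoc)

lemma rep_mono: "f \<in> rep G K \<Longrightarrow> K \<subseteq> L \<Longrightarrow> f \<in> rep G L"
  by (induction rule: rep.induct) (auto intro: rep.intros)

text \<open>
  Multiplication by \<open>e\<close> acts on each summand, so it is enough to know what it does to the monomials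
  of single multiples of \<open>G\<close>.
\<close>

lemma rep_mult:
  assumes "f \<in> rep G K" "\<And>g a. g \<in> G \<Longrightarrow> supp (a *s g) \<subseteq> K \<Longrightarrow> supp (e *s (a *s g)) \<subseteq> L"
  shows "e *s f \<in> rep G L"
  using assms(1)
proof induction
  case rep_zero
  then show ?case by (simp add: act_zero_right rep.rep_zero)
next
  case (rep_step f g a)
  then have "(e * a) *s g + e *s f \<in> rep G L"
    using assms(2) by (intro rep.rep_step) (auto simp: act_mult)
  then show ?case by (simp add: act_add_right act_mult)
qed

lemma rep_scale: "f \<in> rep G K \<Longrightarrow> r \<in> R \<Longrightarrow> r *s f \<in> rep G K"
  by (erule rep_mult) (use supp_scale in blast)

lemma rep_mult_below:
  assumes "f \<in> rep G (below w)" "w \<in> N" "e \<noteq> 0"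
  shows "e *s f \<in> rep G (below (lead (e *s w)))"
  using assms(1) by (rule rep_mult) (use supp_mult_below assms in blast)

lemma rep_supp: "f \<in> rep G K \<Longrightarrow> supp f \<subseteq> K"
proof (induction rule: rep.induct)
  case (rep_step f g a)
  then show ?case using supp_add[of "a *s g" f] by auto
qed (simp add: supp_zero)

text \<open>
  Only finitely many summands occur, so the monomials used have a largest one. This provides the
  bound on which the descent in the proof of the criterion operates.
\<close>

lemma rep_at_most:
  assumes "f \<in> rep G K" "K \<subseteq> N" "f \<noteq> 0"
  shows "\<exists>w\<in>K. f \<in> rep G (at_most w)"
proof -
  have "f = 0 \<or> (\<exists>w\<in>K. f \<in> rep G (at_most w))"
    using assms(1)
  proof induction
    case (rep_step f g a)
    show ?case
    proof (cases "a *s g = 0")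
      case True
      then show ?thesis using rep_step by simp
    next
      case False
      note v = lead(1,2)[OF False]
      let ?v = "lead (a *s g)"
      have vK: "?v \<in> K" using v rep_step by blast
      have one: "a *s g \<in> rep G (at_most ?v)" using rep_single rep_step v by blast
      show ?thesis
      proof (cases "f = 0")
        case True
        then show ?thesis using one vK by auto
      next
        case False
        then obtain w where w: "w \<in> K" "f \<in> rep G (at_most w)" using rep_step by blast
        then have "(w, ?v) \<in> le \<or> (?v, w) \<in> le" using le_total vK assms(2) by blast
        then have "at_most w \<subseteq> at_most ?v \<or> at_most ?v \<subseteq> at_most w"
          unfolding at_most_def using le_trans by blast
        then show ?thesis
        proof
          assume "at_most w \<subseteq> at_most ?v"
          then show ?thesis using rep_add[OF one rep_mono[OF w(2)]] vK by blast
        next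
          assume "at_most ?v \<subseteq> at_most w"
          then show ?thesis using rep_add[OF rep_mono[OF one] w(2)] w(1) by blast
        qed
      qed
    qed
  qed simp
  then show ?thesis using assms(3) by blast
qed

lemma rep_imp_indexed_sum:
  "f \<in> rep G K \<Longrightarrow> \<exists>(q::nat) a g. (\<forall>i<q. g i \<in> G \<and> supp (a i *s g i) \<subseteq> K) \<and>
      f = (\<Sum>i<q. a i *s g i)"
proof (induction rule: rep.induct)
  case rep_zero
  then show ?case by (intro exI[of _ 0]) simp
next
  case (rep_step f g a)
  from rep_step.IH obtain q :: nat and b h where "\<forall>i<q. h i \<in> G \<and> supp (b i *s h i) \<subseteq> K"
    "f = (\<Sum>i<q. b i *s h i)" by blast
  then show ?case
    using rep_step
    by (intro exI[of _ "Suc q"] exI[of _ "b(q := a)"] exI[of _ "h(q := g)"])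
      (auto simp: less_Suc_eq add.commute)
qed

lemma indexed_sum_imp_rep:
  "(\<forall>i<q. g i \<in> G \<and> supp (a i *s g i) \<subseteq> K) \<Longrightarrow> (\<Sum>i<(q::nat). a i *s g i) \<in> rep G K"
  by (induction q) (auto intro: rep_zero rep_step simp: add.commute[of "sum _ _"])

lemma reduces_iff_rep:
  "reduces_to_0 R N le G f \<longleftrightarrow> f = 0 \<or> f \<in> rep G (at_most (lead f))"
proof -
  have bound: "(a *s g \<noteq> 0 \<longrightarrow> (lead (a *s g), lead f) \<in> le) \<longleftrightarrow>
      supp (a *s g) \<subseteq> at_most (lead f)" for a g
  proof (cases "a *s g = 0")
    case True
    then show ?thesis by (simp add: supp_zero)
  next
    case False
    show ?thesis
    proof
      assume "a *s g \<noteq> 0 \<longrightarrow> (lead (a *s g), lead f) \<in> le"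
      then have "at_most (lead (a *s g)) \<subseteq> at_most (lead f)"
        using False le_trans by (auto simp: at_most_def)
      then show "supp (a *s g) \<subseteq> at_most (lead f)" using lead(2)[OF False] by blast
    qed (use lead(1)[OF False] in \<open>auto simp: at_most_def\<close>)
  qed
  have "f \<in> rep G (at_most (lead f)) \<longleftrightarrow>
      (\<exists>(q::nat) a g. (\<forall>i<q. g i \<in> G \<and> supp (a i *s g i) \<subseteq> at_most (lead f)) \<and>
        f = (\<Sum>i<q. a i *s g i))"
    using rep_imp_indexed_sum[of f G "at_most (lead f)"]
      indexed_sum_imp_rep[of _ _ G _ "at_most (lead f)"] by blast
  then show ?thesis unfolding reduces_to_0_def bound by blast
qed

lemma rep_submodule: "left_submodule (rep G N)"
  unfolding left_submodule_def
  using rep_zero rep_add rep_mult[of _ G N _ N] supp_subset by blast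

lemma submodule_hull_eq_rep: "left_submodule hull G = rep G N"
proof (rule hull_unique)
  show "G \<subseteq> rep G N"
    using rep_single[of _ G 1 N] supp_subset by (auto simp: act_one)
  show "left_submodule (rep G N)" by (rule rep_submodule)
  fix M assume M: "G \<subseteq> M" "left_submodule M"
  show "rep G N \<subseteq> M"
  proof
    fix f assume "f \<in> rep G N"
    then show "f \<in> M"
      by induction (use M in \<open>auto simp: left_submodule_def\<close>)
  qed
qed

section \<open>The S-vector criterion\<close>

abbreviation S_vect :: "'a ^ 'p \<Rightarrow> 'a ^ 'p \<Rightarrow> 'a ^ 'p" where
  "S_vect f g \<equiv> (let w = lcmul (lead f) (lead g)
      in left_quotient w (lterm f) *s f - left_quotient w (lterm g) *s g)"

text \<open>
  Division by \<open>G\<close>: subtracting a multiple of \<open>g\<close> that has the same leading term as \<open>f\<close> leaves a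
  vector of \<open>M\<close> with a smaller leading monomial.
\<close>

lemma GS_basis_rep:
  assumes M: "left_submodule M" "G \<subseteq> M" "0 \<notin> G"
    and GS: "\<And>f. f \<in> M \<Longrightarrow> f \<noteq> 0 \<Longrightarrow> \<exists>g\<in>G. multiple (lead f) (lead g)"
    and f: "f \<in> M" "f \<noteq> 0"
  shows "f \<in> rep G (at_most (lead f))"
  using f
proof (induction "lead f" arbitrary: f rule: wf_induct_rule[OF wf_less])
  case 1
  obtain g where g: "g \<in> G" "multiple (lead f) (lead g)" using GS 1 by blast
  then have g0: "g \<noteq> 0" using M by auto
  obtain h where h: "h *s lterm g = lead f" using lterm_quotient[OF g0 g(2)] by blast
  note f0 = \<open>f \<noteq> 0\<close>
  let ?c = "lc R N le f"
  let ?a = "?c * h"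
  let ?r = "f - ?a *s g"
  have below_c: "supp (?c *s (h *s g - lead f)) \<subseteq> below (lead f)"
    using quotient_remainder[OF g0 h lead(3)[OF f0]] supp_scale[OF lterm(2)[OF f0]] by blast
  have r_eq: "?r = (f - lterm f) - ?c *s (h *s g - lead f)"
    by (simp add: lterm(1)[OF f0] vec_eq_iff algebra_simps)
  have r: "supp ?r \<subseteq> below (lead f)"
    unfolding r_eq by (rule supp_diff_subset[OF lterm(4)[OF f0] below_c])
  have "?r \<in> M"
  proof -
    have "(- ?a) *s g \<in> M" using M g unfolding left_submodule_def by blast
    then have "f + (- ?a) *s g \<in> M" using M \<open>f \<in> M\<close> unfolding left_submodule_def by blast
    then show ?thesis by (simp add: act_minus)
  qed
  have "?r \<in> rep G (at_most (lead f))"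
  proof (cases "?r = 0")
    case True
    then show ?thesis using rep_zero by simp
  next
    case False
    then have less: "lead ?r \<in> below (lead f)" using r lead(1) by blast
    then have "?r \<in> rep G (at_most (lead ?r))"
      using 1(1)[of ?r] \<open>?r \<in> M\<close> False by (simp add: below_def)
    then show ?thesis
      
      using rep_mono[OF _ order_trans[OF at_most_subset_below[OF less] below_subset_at_most]] by blast
  qed
  moreover have "supp (?a *s g) \<subseteq> at_most (lead f)"
  proof -
    have "?a *s g = f - ?r" by simp
    then have "supp (?a *s g) \<subseteq> supp f \<union> supp ?r" using supp_diff[of f ?r] by simp
    then show ?thesis using r lead(2)[OF f0] below_subset_at_most by blast
  qed
  ultimately have "?a *s g + ?r \<in> rep G (at_most (lead f))" using rep_step g by blast
  then show ?case by simp
qed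

text \<open>
  Two multiples of elements of \<open>G\<close> with the same leading term \<open>w\<close> differ by a left multiple of
  their S-vector, because \<open>w\<close> is a left multiple of the least common multiple and left quotients
  are unique.
\<close>

lemma equal_lterm_diff:
  assumes "0 \<notin> G" "f \<in> G" "g \<in> G"
    and red: "reduces_to_0 R N le G (S_vect f g)"
    and w: "w \<in> N" "a *s lterm f = w" "b *s lterm g = w"
    and mult: "multiple w (lead f)" "multiple w (lead g)"
  shows "a *s f - b *s g \<in> rep G (below w)"
proof -
  have f0: "f \<noteq> 0" and g0: "g \<noteq> 0" using assms by auto
  define z where "z = lcmul (lead f) (lead g)"
  have z: "multiple z (lead f)" "multiple z (lead g)" "multiple w z"
    using lcmul[OF mult] by (auto simp: z_def)
  have zN: "z \<in> N" using z multiple_in by blast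
  define p q where "p = left_quotient z (lterm f)" and "q = left_quotient z (lterm g)"
  have p: "p *s lterm f = z" and q: "q *s lterm g = z"
    unfolding p_def q_def using left_quotient_lterm f0 g0 z by blast+
  let ?s = "p *s f - q *s g"
  have sv: "S_vect f g = ?s" by (simp add: Let_def z_def p_def q_def)
  obtain e where e: "e *s z = w" using multiple_quotient z by blast
  have "a = e * p" "b = e * q"
    using cancel_lterm[OF f0, of a "e * p"] cancel_lterm[OF g0, of b "e * q"] w p q e
    by (simp_all add: act_mult)
  then have diff: "a *s f - b *s g = e *s ?s" by (simp add: vec_eq_iff algebra_simps)
  \<comment> \<open>The common leading term \<open>z\<close> cancels in the S-vector, so its representation is below \<open>z\<close>.\<close>
  have "?s = (p *s f - z) - (q *s g - z)" by simp
  then have "supp ?s \<subseteq> below z"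
    using supp_diff_subset[OF quotient_remainder[OF f0 p zN] quotient_remainder[OF g0 q zN]]
    by simp
  then have "?s \<in> rep G (below z)"
    using red lead(1)[of ?s] at_most_subset_below[of "lead ?s" z]
      rep_mono[of ?s G "at_most (lead ?s)"] rep_zero[of G]
    unfolding sv reduces_iff_rep by (cases "?s = 0") auto
  moreover have "e \<noteq> 0" and "lead (e *s z) = w"
    using e w supp_monomial[OF w(1)] supp_zero act_zero[of z] lead_eqI[of w w]
      le_refl by (auto simp: at_most_def)
  ultimately show ?thesis using rep_mult_below[of ?s G z e] zN diff by simp
qed

text \<open>
  Merging one summand at a time avoids collecting the summands at \<open>w\<close> and telescoping: in a new
  summand, \<open>d *s (b *s g)\<close> may be exchanged for \<open>d *s (b' *s h)\<close> with the \<open>b'\<close> and \<open>h\<close> already chosen.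
\<close>

lemma rep_merge_top:
  assumes G: "0 \<notin> G"
    and red: "\<forall>f\<in>G. \<forall>g\<in>G. reduces_to_0 R N le G (S_vect f g)"
    and w: "w \<in> N"
    and f: "f \<in> rep G (at_most w)"
  shows "f \<in> rep G (below w) \<or>
    (\<exists>d\<in>R. \<exists>b. \<exists>g\<in>G. multiple w (lead g) \<and> b *s lterm g = w \<and>
      f - d *s (b *s g) \<in> rep G (below w))"
  using f
proof induction
  case (rep_step f g a)
  have top: "\<exists>d\<in>R. \<exists>b. multiple w (lead g) \<and> b *s lterm g = w \<and>
      a *s g - d *s (b *s g) \<in> rep G (below w)" if *: "\<not> supp (a *s g) \<subseteq> below w"
  proof -
    have g0: "g \<noteq> 0" using rep_step G by auto
    have nz: "a *s g \<noteq> 0" using * supp_zero by auto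
    have "w \<in> supp (a *s g)" using * rep_step at_most_below[OF w] by auto
    then have lead_w: "lead (a *s g) = w" using lead_eqI rep_step by blast
    then have mult: "multiple w (lead g)" using lead_of_mult[OF nz g0] by simp
    obtain b where b: "b *s lterm g = w" using lterm_quotient[OF g0 mult] by blast
    let ?d = "lc R N le (a *s g)"
    have eq: "a *s g - ?d *s (b *s g) = (a *s g - lterm (a *s g)) - ?d *s (b *s g - w)"
      by (simp add: lterm(1)[OF nz] lead_w vec_eq_iff algebra_simps)
    have "supp (a *s g - lterm (a *s g)) \<subseteq> below w"
      using lterm(4)[OF nz] lead_w by simp
    moreover have "supp (?d *s (b *s g - w)) \<subseteq> below w"
      using quotient_remainder[OF g0 b w] supp_scale[OF lterm(2)[OF nz]] by blast
    ultimately have "supp (a *s g - ?d *s (b *s g)) \<subseteq> below w"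
      unfolding eq by (rule supp_diff_subset)
    moreover have "a *s g - ?d *s (b *s g) = (a - ?d * b) *s g"
      by (simp add: vec_eq_iff algebra_simps)
    ultimately have "a *s g - ?d *s (b *s g) \<in> rep G (below w)"
      using rep_single[OF rep_step.hyps(2)] by simp
    then show ?thesis using mult b lterm(2)[OF nz] by blast
  qed
  show ?case
  proof (cases "supp (a *s g) \<subseteq> below w")
    case True
    then have ag: "a *s g \<in> rep G (below w)" using rep_single rep_step by blast
    from rep_step.IH show ?thesis
    proof (elim disjE bexE exE conjE)
      assume "f \<in> rep G (below w)"
      then show ?thesis using ag rep_add by blast
    next
      fix d b h
      assume *: "d \<in> R" "h \<in> G" "multiple w (lead h)" "b *s lterm h = w"
        "f - d *s (b *s h) \<in> rep G (below w)"
      have "a *s g + (f - d *s (b *s h)) \<in> rep G (below w)" using * ag rep_add by blast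
      then show ?thesis using * by (simp add: add_diff_eq) blast
    qed
  next
    case False
    then obtain d b where db: "d \<in> R" "multiple w (lead g)" "b *s lterm g = w"
      "a *s g - d *s (b *s g) \<in> rep G (below w)" using top by blast
    from rep_step.IH show ?thesis
    proof (elim disjE bexE exE conjE)
      assume "f \<in> rep G (below w)"
      then have "a *s g - d *s (b *s g) + f \<in> rep G (below w)" using db rep_add by blast
      then have "a *s g + f - d *s (b *s g) \<in> rep G (below w)" by (simp add: algebra_simps)
      then show ?thesis using db rep_step by blast
    next
      fix d' b' h
      assume h: "d' \<in> R" "h \<in> G" "multiple w (lead h)" "b' *s lterm h = w"
        "f - d' *s (b' *s h) \<in> rep G (below w)"
      have "b *s g - b' *s h \<in> rep G (below w)"
        
        using equal_lterm_diff[OF G rep_step.hyps(2) h(2) _ w db(3) h(4) db(2) h(3)]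
          red rep_step.hyps(2) h(2) by blast
      then have "d *s (b *s g - b' *s h) \<in> rep G (below w)" using rep_scale db by blast
      then have "d *s (b *s g - b' *s h) + (a *s g - d *s (b *s g)) + (f - d' *s (b' *s h))
          \<in> rep G (below w)" using rep_add db h by blast
      moreover have "d *s (b *s g - b' *s h) + (a *s g - d *s (b *s g)) + (f - d' *s (b' *s h))
          = a *s g + f - (d + d') *s (b' *s h)"
        by (simp add: vec_eq_iff algebra_simps)
      ultimately show ?thesis using h db add_R by metis
    qed
  qed
qed (simp add: rep_zero)

text \<open>
  Descent on the bound \<open>w\<close>. After merging, the coefficient of \<open>w\<close> in \<open>f\<close> is the scalar \<open>d\<close> of the
  merged summand, so either \<open>w\<close> is the leading monomial or a smaller bound exists.
\<close>

lemma rep_lead_multiple: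
  assumes G: "0 \<notin> G"
    and red: "\<forall>f\<in>G. \<forall>g\<in>G. reduces_to_0 R N le G (S_vect f g)"
    and f: "f \<noteq> 0" "w \<in> N" "f \<in> rep G (at_most w)"
  shows "\<exists>g\<in>G. multiple (lead f) (lead g)"
  using f(2,3)
proof (induction w rule: wf_induct_rule[OF wf_less])
  case (1 w)
  have lower: ?case if low: "f \<in> rep G (below w)"
  proof -
    have "below w \<subseteq> N" using le_in_N by (auto simp: below_def)
    then obtain v where "v \<in> below w" "f \<in> rep G (at_most v)"
      using rep_at_most[OF low] f by blast
    then show ?thesis using 1(1)[of v] le_in_N by (auto simp: below_def)
  qed
  from rep_merge_top[OF G red 1(2,3)] show ?case
  proof (elim disjE bexE exE conjE)
    fix d b g
    assume *: "d \<in> R" "g \<in> G" "multiple w (lead g)" "b *s lterm g = w"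
        "f - d *s (b *s g) \<in> rep G (below w)"
    have g0: "g \<noteq> 0" using * G by auto
    have "supp (f - d *s (b *s g)) \<subseteq> below w" using rep_supp * by blast
    moreover have "supp (b *s g - w) \<subseteq> below w"
      using quotient_remainder[OF g0] * 1 by blast
    ultimately have "coef (f - d *s (b *s g)) w = 0" "coef (b *s g - w) w = 0"
      by (auto simp: supp_coef below_def)
    then have c: "coef f w = d" using * 1 by (simp add: coef_diff coef_scale coef_basis)
    show ?thesis
    proof (cases "d = 0")
      case True
      then show ?thesis using * lower act_zero by simp
    next
      case False
      then have "w \<in> supp f" using c by (simp add: supp_coef)
      then have "lead f = w" using lead_eqI rep_supp 1 by blast
      then show ?thesis using * by blast
    qed
  qed (rule lower)
qed

theorem S_vect_criterion:
  assumes G: "0 \<notin> G" and M: "M = left_submodule hull G"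
  shows "(\<forall>f\<in>M. f \<noteq> 0 \<longrightarrow> (\<exists>g\<in>G. multiple (lead f) (lead g))) \<longleftrightarrow>
    (\<forall>f\<in>G. \<forall>g\<in>G. reduces_to_0 R N le G (S_vect f g))"
proof (intro iffI ballI impI)
  fix f g
  assume GS: "\<forall>f\<in>M. f \<noteq> 0 \<longrightarrow> (\<exists>g\<in>G. multiple (lead f) (lead g))" and "f \<in> G" "g \<in> G"
  have sub: "left_submodule M" using M submodule_hull_eq_rep rep_submodule by simp
  have GM: "G \<subseteq> M" unfolding M by (rule hull_subset)
  have "a *s f - b *s g \<in> M" for a b
  proof -
    have "a *s f + (- b) *s g \<in> M"
      using sub GM \<open>f \<in> G\<close> \<open>g \<in> G\<close> unfolding left_submodule_def by blast
    then show ?thesis by (simp add: act_minus)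
  qed
  then have "S_vect f g \<in> M" by (simp add: Let_def)
  then show "reduces_to_0 R N le G (S_vect f g)"
    using GS_basis_rep[OF sub GM G] GS unfolding reduces_iff_rep by blast
next
  fix f
  assume red: "\<forall>f\<in>G. \<forall>g\<in>G. reduces_to_0 R N le G (S_vect f g)" and f: "f \<in> M" "f \<noteq> 0"
  have "f \<in> rep G N" using f M submodule_hull_eq_rep by simp
  then obtain w where "w \<in> N" "f \<in> rep G (at_most w)" using rep_at_most f by blast
  then show "\<exists>g\<in>G. multiple (lead f) (lead g)" using rep_lead_multiple[OF G] red f by blast
qed

end


section \<open>Derivations of finite field extensions in characteristic zero\<close>

text \<open>
  If two powers of \<open>r\<close> coincide, the relation is \<open>r ^ j - r ^ i = 0\<close>; otherwise there are more
  powers than the dimension allows.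
\<close>

lemma finite_extension_algebraic:
  assumes alg: "k_algebra smul" and ext: "finite_field_extension smul R" and r: "r \<in> R"
  shows "\<exists>N c. (\<exists>i\<le>N. c i \<noteq> 0) \<and> (\<Sum>i\<le>(N::nat). smul (c i) (r ^ i)) = 0"
proof -
  interpret k_algebra smul by fact
  have R: "1 \<in> R" "\<And>x y. x \<in> R \<Longrightarrow> y \<in> R \<Longrightarrow> x * y \<in> R"
    using ext by (auto simp: finite_field_extension_def subalgebra_def)
  obtain B where B: "finite B" "span B = R"
    using ext unfolding finite_field_extension_def by blast
  have pow: "r ^ i \<in> R" for i by (induction i) (use R r in auto)
  show ?thesis
  proof (cases "inj_on (\<lambda>i. r ^ i) {..card B}")
    case True
    let ?P = "(\<lambda>i. r ^ i) ` {..card B}"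
    have "card ?P = Suc (card B)" using True by (simp add: card_image)
    then have "dependent ?P" using independent_span_bound[OF B(1), of ?P] pow B(2) by auto
    then obtain u where "\<exists>v\<in>?P. u v \<noteq> 0" "(\<Sum>v\<in>?P. smul (u v) v) = 0"
      by (subst (asm) dependent_finite) auto
    then show ?thesis
      by (intro exI[of _ "card B"] exI[of _ "\<lambda>i. u (r ^ i)"]) (auto simp: sum.reindex[OF True])
  next
    case False
    then obtain i j where ij: "i < j" "r ^ i = r ^ j"
      unfolding inj_on_def by (metis linorder_neqE_nat)
    let ?c = "\<lambda>k. if k = j then 1 else if k = i then - 1 else 0"
    have "(\<Sum>k\<le>j. smul (?c k) (r ^ k)) = (\<Sum>k\<in>{i, j}. smul (?c k) (r ^ k))"
      by (rule sum.mono_neutral_right) (use ij in auto)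
    also have "\<dots> = 0" using ij by simp
    finally show ?thesis by (intro exI[of _ j] exI[of _ ?c]) auto
  qed
qed

text \<open>
  Differentiating a relation of minimal degree gives \<open>e * d r = 0\<close>, where \<open>e\<close> is the value at \<open>r\<close> of
  the formal derivative. This has smaller degree and, in characteristic zero, a nonzero leading
  coefficient, so \<open>e \<noteq> 0\<close>.
\<close>

lemma derivation_eq_zero:
  fixes smul :: "'k::field_char_0 \<Rightarrow> 'a::ring_1 \<Rightarrow> 'a"
  assumes alg: "k_algebra smul" and ext: "finite_field_extension smul R"
    and der: "derivation_on smul R d" and r: "r \<in> R"
  shows "d r = 0"
proof -
  interpret k_algebra smul by fact
  have sub: "subspace R" and one: "1 \<in> R" and mult: "\<And>x y. x \<in> R \<Longrightarrow> y \<in> R \<Longrightarrow> x * y \<in> R"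
    and comm: "\<And>x y. x \<in> R \<Longrightarrow> y \<in> R \<Longrightarrow> x * y = y * x"
    and inv: "\<And>x. x \<in> R \<Longrightarrow> x \<noteq> 0 \<Longrightarrow> \<exists>y\<in>R. x * y = 1"
    using ext by (auto simp: finite_field_extension_def subalgebra_def)
  have pow: "r ^ i \<in> R" for i by (induction i) (use one mult r in auto)
  have d_in: "d x \<in> R" and d_add: "d (x + y) = d x + d y"
    and d_smul: "d (smul c x) = smul c (d x)" and d_mult: "d (x * y) = x * d y + d x * y"
    if "x \<in> R" "y \<in> R" for x y c
    using der that by (auto simp: derivation_on_def)
  have d_zero: "d 0 = 0" using d_add[of 0 0] subspace_0[OF sub] by simp
  have d_one: "d 1 = 0" using d_mult[of 1 1] one by simp
  have d_pow: "d (r ^ Suc i) = of_nat (Suc i) * r ^ i * d r" for i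
  proof (induction i)
    case (Suc i)
    have "d (r ^ Suc (Suc i)) = r * d (r ^ Suc i) + d r * r ^ Suc i"
      using d_mult[OF r pow[of "Suc i"]] by simp
    also have "d r * r ^ Suc i = r ^ Suc i * d r" using comm d_in[OF r r] pow by blast
    also have "r * d (r ^ Suc i) = of_nat (Suc i) * r ^ Suc i * d r"
      unfolding Suc by (simp only: power_Suc mult.assoc)
        (metis mult.assoc mult_of_nat_commute)
    finally show ?case by (simp add: algebra_simps)
  qed (simp add: d_one)
  have d_sum: "d (sum f F) = (\<Sum>i\<in>F. d (f i))" if "\<And>i. f i \<in> R" for f :: "nat \<Rightarrow> 'a" and F
    by (induction F rule: infinite_finite_induct)
      (simp_all add: d_zero d_add that subspace_sum[OF sub])
  have pow_sum: "(\<Sum>i\<le>N. smul (c i) (r ^ i)) \<in> R" for N :: nat and c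
    using sub pow by (intro subspace_sum subspace_scale) auto
  define dep where "dep N \<longleftrightarrow>
    (\<exists>c. (\<exists>i\<le>N. c i \<noteq> 0) \<and> (\<Sum>i\<le>(N::nat). smul (c i) (r ^ i)) = 0)" for N
  define N where "N = (LEAST N. dep N)"
  have "\<exists>N. dep N" using finite_extension_algebraic[OF alg ext r] by (simp add: dep_def)
  then have "dep N" and minimal: "\<And>K. K < N \<Longrightarrow> \<not> dep K"
    unfolding N_def using LeastI_ex not_less_Least by blast+
  then obtain c where c: "\<exists>i\<le>N. c i \<noteq> 0" "(\<Sum>i\<le>N. smul (c i) (r ^ i)) = 0"
    unfolding dep_def by blast
  have "N \<noteq> 0"
  proof
    assume "N = 0"
    then have "c 0 \<noteq> 0" "smul (c 0) 1 = 0" using c by auto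
    then show False by (simp add: scale_eq_0_iff)
  qed
  then obtain K where K: "N = Suc K" by (cases N) auto
  define e where "e = (\<Sum>i\<le>K. smul (of_nat (Suc i) * c (Suc i)) (r ^ i))"
  have e_R: "e \<in> R" unfolding e_def by (rule pow_sum)
  have "c N \<noteq> 0"
  proof
    assume 0: "c N = 0"
    then have "\<exists>i\<le>K. c i \<noteq> 0" using c(1) K by (metis le_Suc_eq)
    moreover have "(\<Sum>i\<le>K. smul (c i) (r ^ i)) = 0" using c(2) 0 K by simp
    ultimately show False using minimal[of K] K unfolding dep_def by blast
  qed
  then have top: "of_nat (Suc K) * c (Suc K) \<noteq> 0" using K by (simp del: of_nat_Suc)
  have "e \<noteq> 0"
  proof
    assume "e = 0"
    with top have "dep K"
      unfolding dep_def e_def by (intro exI[of _ "\<lambda>i. of_nat (Suc i) * c (Suc i)"]) blast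
    then show False using minimal[of K] K by simp
  qed
  have smul_of_nat: "smul (of_nat k) x = of_nat k * x" for k x
    by (induction k) (simp_all add: scale_left_distrib algebra_simps)
  have "0 = d (\<Sum>i\<le>N. smul (c i) (r ^ i))" by (simp add: c(2) d_zero)
  also have "\<dots> = (\<Sum>i\<le>N. smul (c i) (d (r ^ i)))"
    using sub pow by (subst d_sum) (auto intro: subspace_scale simp: d_smul[OF pow pow])
  also have "\<dots> = (\<Sum>i\<le>K. smul (c (Suc i)) (d (r ^ Suc i)))"
    unfolding K by (subst sum.atMost_Suc_shift) (simp add: d_one)
  also have "\<dots> = (\<Sum>i\<le>K. smul (of_nat (Suc i) * c (Suc i)) (r ^ i) * d r)"
  proof (rule sum.cong)
    fix i
    have "smul (c (Suc i)) (d (r ^ Suc i)) = smul (c (Suc i)) (smul (of_nat (Suc i)) (r ^ i)) * d r"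
      unfolding d_pow smul_of_nat by (rule scale_mult_left)
    then show "smul (c (Suc i)) (d (r ^ Suc i)) = smul (of_nat (Suc i) * c (Suc i)) (r ^ i) * d r"
      by (simp add: mult.commute)
  qed simp
  also have "\<dots> = e * d r" unfolding e_def by (rule sum_distrib_right[symmetric])
  finally have zero: "e * d r = 0" by simp
  obtain y where "e * y = 1" "y \<in> R" using inv[OF e_R \<open>e \<noteq> 0\<close>] by blast
  then have "y * e = 1" using comm[OF e_R] by metis
  then show ?thesis using mult.assoc[of y e "d r"] zero by simp
qed


section \<open>Ordered products of powers\<close>

definition ordered_power :: "(nat \<Rightarrow> 'a::ring_1) \<Rightarrow> nat \<Rightarrow> nat \<Rightarrow> (nat \<Rightarrow> nat) \<Rightarrow> 'a" where
  "ordered_power x a b \<alpha> = prod_list (map (\<lambda>i. x i ^ \<alpha> i) [a..<b])"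

lemma Xpow_split: "Xpow (m + n) x \<alpha> = ordered_power x 0 m \<alpha> * ordered_power x m (m + n) \<alpha>"
  unfolding Xpow_def ordered_power_def by (simp add: upt_add_eq_append[of 0 m n])

lemma ordered_power_Suc:
  "a \<le> b \<Longrightarrow> ordered_power x a (Suc b) \<alpha> = ordered_power x a b \<alpha> * x b ^ \<alpha> b"
  by (simp add: ordered_power_def)

lemma ordered_power_update:
  "j \<notin> {a..<b} \<Longrightarrow> ordered_power x a b (\<alpha>(j := k)) = ordered_power x a b \<alpha>"
  unfolding ordered_power_def by (intro arg_cong[of _ _ prod_list] map_cong) auto

text \<open>
  Rules for moving elements past a product of generators follow from the rules for the generators,
  when \<open>Q\<close> collects the factors that admit such a rule.
\<close>

lemma ordered_power_in:
  assumes "1 \<in> Q" "\<And>p q. p \<in> Q \<Longrightarrow> q \<in> Q \<Longrightarrow> p * q \<in> Q" "\<And>i. i \<in> {a..<b} \<Longrightarrow> x i \<in> Q"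
  shows "ordered_power x a b \<alpha> \<in> Q"
proof -
  have "x i ^ k \<in> Q" if "i \<in> {a..<b}" for i k
    by (induction k) (use assms that in auto)
  moreover have "set ys \<subseteq> Q \<Longrightarrow> prod_list ys \<in> Q" for ys
    by (induction ys) (use assms in auto)
  ultimately show ?thesis unfolding ordered_power_def by (auto simp: image_subset_iff)
qed

lemma ordered_power_mult_commuting:
  assumes "\<And>i j. i \<in> {a..<b} \<Longrightarrow> j \<in> {a..<b} \<Longrightarrow> x i * x j = x j * x i" "j \<in> {a..<b}"
  shows "x j * ordered_power x a b \<alpha> = ordered_power x a b (\<alpha>(j := Suc (\<alpha> j)))"
  using assms
proof (induction b arbitrary: j)
  case (Suc b)
  then have ab: "a \<le> b" by auto
  show ?case
  proof (cases "j = b")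
    case True
    have "ordered_power x a b \<alpha> \<in> {p. x b * p = p * x b}"
      by (rule ordered_power_in) (use Suc.prems ab in \<open>auto simp: mult.assoc, metis mult.assoc\<close>)
    then have "x b * ordered_power x a b \<alpha> = ordered_power x a b \<alpha> * x b" by simp
    moreover have "ordered_power x a b (\<alpha>(b := Suc (\<alpha> b))) = ordered_power x a b \<alpha>"
      by (rule ordered_power_update) simp
    ultimately show ?thesis
      using True ab by (simp add: ordered_power_Suc fun_upd_def flip: mult.assoc)
  next
    case False
    then have "x j * ordered_power x a b \<alpha> = ordered_power x a b (\<alpha>(j := Suc (\<alpha> j)))"
      by (intro Suc.IH Suc.prems) (use Suc.prems False in auto)
    then show ?thesis
      using ab False by (simp add: ordered_power_Suc fun_upd_def flip: mult.assoc)
  qed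
qed simp


section \<open>Multiplication of monomials in a differential difference algebra\<close>

locale dd_over_field =
  fixes smul :: "'k::field_char_0 \<Rightarrow> 'a::ring_1 \<Rightarrow> 'a"
    and R :: "'a set" and m n :: nat and S D :: "nat \<Rightarrow> 'a" and \<sigma> \<delta> :: "nat \<Rightarrow> 'a \<Rightarrow> 'a"
  assumes dd: "dd_algebra smul R m n S D \<sigma> \<delta>"
    and ext: "finite_field_extension smul R"
begin

abbreviation x :: "nat \<Rightarrow> 'a" where "x \<equiv> gens m S D"
abbreviation X :: "(nat \<Rightarrow> nat) \<Rightarrow> 'a" where "X \<equiv> Xpow (m + n) x"

definition T :: "'a set" where "T = subalgebra smul hull (R \<union> D ` {..<n})"

lemma alg: "k_algebra smul"
  and X_basis: "left_basis (*) R (expos (m + n)) X"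
  and derivation: "i < n \<Longrightarrow> derivation_on smul R (\<delta> i)"
  and D_mult: "i < n \<Longrightarrow> r \<in> R \<Longrightarrow> D i * r = r * D i + \<delta> i r"
  and auto_T: "i < m \<Longrightarrow> algebra_automorphism_on smul T (\<sigma> i)"
  and auto_R: "i < m \<Longrightarrow> algebra_automorphism_on smul R (\<sigma> i)"
  and \<sigma>_D: "i < m \<Longrightarrow> j < n \<Longrightarrow>
      \<exists>a. (\<forall>s<n. a s \<in> R) \<and> \<sigma> i (D j) = (\<Sum>s<n. a s * D s)"
  and S_mult: "i < m \<Longrightarrow> r \<in> R \<Longrightarrow> S i * r = inv_into T (\<sigma> i) r * S i"
  and D_S: "i < n \<Longrightarrow> j < m \<Longrightarrow> D i * S j = S j * \<sigma> j (D i)"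
  and S_comm: "i < m \<Longrightarrow> j < m \<Longrightarrow> S i * S j = S j * S i"
  and D_comm: "i < n \<Longrightarrow> j < n \<Longrightarrow> D i * D j = D j * D i"
proof -
  note axioms = dd[unfolded dd_algebra_def Let_def, folded T_def]
  note a1 = conjunct2[OF conjunct2[OF axioms]]
  note a2 = conjunct2[OF a1]
  note a3 = conjunct2[OF a2]
  note a4 = conjunct2[OF a3]
  note a5 = conjunct2[OF a4]
  note a6 = conjunct2[OF a5]
  show "k_algebra smul" by (rule conjunct1[OF axioms])
  show "left_basis (*) R (expos (m + n)) X" by (rule conjunct1[OF a1])
  show "i < n \<Longrightarrow> derivation_on smul R (\<delta> i)"
    "i < n \<Longrightarrow> r \<in> R \<Longrightarrow> D i * r = r * D i + \<delta> i r"
    using conjunct1[OF a2] by blast+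
  show "i < m \<Longrightarrow> algebra_automorphism_on smul T (\<sigma> i)"
    "i < m \<Longrightarrow> algebra_automorphism_on smul R (\<sigma> i)"
    "i < m \<Longrightarrow> j < n \<Longrightarrow> \<exists>a. (\<forall>s<n. a s \<in> R) \<and> \<sigma> i (D j) = (\<Sum>s<n. a s * D s)"
    "i < m \<Longrightarrow> r \<in> R \<Longrightarrow> S i * r = inv_into T (\<sigma> i) r * S i"
    using conjunct1[OF a3] by blast+
  show "i < n \<Longrightarrow> j < m \<Longrightarrow> D i * S j = S j * \<sigma> j (D i)" using conjunct1[OF a4] by blast
  show "i < m \<Longrightarrow> j < m \<Longrightarrow> S i * S j = S j * S i" using conjunct1[OF a5] by blast
  show "i < n \<Longrightarrow> j < n \<Longrightarrow> D i * D j = D j * D i" using conjunct1[OF a6] by blast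
qed

sublocale k_algebra smul by (rule alg)

lemma subalgebra_R: "subalgebra smul R"
  using ext by (simp add: finite_field_extension_def)

lemma subalgebra_T: "subalgebra smul T"
  unfolding T_def by (rule hull_in) (auto simp: subalgebra_def subspace_def)

lemma R_subset_T: "R \<subseteq> T" and D_in_T: "i < n \<Longrightarrow> D i \<in> T"
  using hull_subset[of "R \<union> D ` {..<n}" "subalgebra smul"] by (auto simp: T_def)

lemma R_one: "1 \<in> R" and R_add: "r \<in> R \<Longrightarrow> s \<in> R \<Longrightarrow> r + s \<in> R"
  and R_mult: "r \<in> R \<Longrightarrow> s \<in> R \<Longrightarrow> r * s \<in> R" and R_neg: "r \<in> R \<Longrightarrow> - r \<in> R"
  and R_zero: "0 \<in> R"
  using subalgebra_R subspace_neg[of R] by (auto simp: subalgebra_def subspace_def)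

lemma R_inverse: "r \<in> R \<Longrightarrow> r \<noteq> 0 \<Longrightarrow> \<exists>s\<in>R. s * r = 1"
  using ext unfolding finite_field_extension_def by metis

lemma D_central: "i < n \<Longrightarrow> r \<in> R \<Longrightarrow> D i * r = r * D i"
  using D_mult derivation_eq_zero[OF alg ext derivation] by simp

lemma S_\<sigma>_R: "i < m \<Longrightarrow> r \<in> R \<Longrightarrow> S i * \<sigma> i r = r * S i"
proof -
  assume i: "i < m" and r: "r \<in> R"
  have "\<sigma> i r \<in> R" using auto_R[OF i] r unfolding algebra_automorphism_on_def
    by (blast dest: bij_betwE)
  moreover have "inv_into T (\<sigma> i) (\<sigma> i r) = r"
    using auto_T[OF i] r R_subset_T unfolding algebra_automorphism_on_def
    by (auto intro: inv_into_f_f dest: bij_betw_imp_inj_on)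
  ultimately show ?thesis using S_mult[OF i] by simp
qed

text \<open>
  The commutation rule for \<open>R\<close> and the one for the \<open>D j\<close> are instances of a single rule, which
  extends to all of \<open>T\<close> because both sides are multiplicative in \<open>t\<close>.
\<close>

lemma S_\<sigma>_T:
  assumes i: "i < m" and t: "t \<in> T"
  shows "S i * \<sigma> i t = t * S i"
proof -
  let ?U = "{t \<in> T. S i * \<sigma> i t = t * S i}"
  have T: "0 \<in> T" "1 \<in> T" "\<And>u v. u \<in> T \<Longrightarrow> v \<in> T \<Longrightarrow> u + v \<in> T"
    "\<And>u v. u \<in> T \<Longrightarrow> v \<in> T \<Longrightarrow> u * v \<in> T" "\<And>c u. u \<in> T \<Longrightarrow> smul c u \<in> T"
    using subalgebra_T by (auto simp: subalgebra_def subspace_def)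
  have \<sigma>: "\<And>u v. u \<in> T \<Longrightarrow> v \<in> T \<Longrightarrow> \<sigma> i (u + v) = \<sigma> i u + \<sigma> i v"
    "\<And>u v. u \<in> T \<Longrightarrow> v \<in> T \<Longrightarrow> \<sigma> i (u * v) = \<sigma> i u * \<sigma> i v"
    "\<And>c u. u \<in> T \<Longrightarrow> \<sigma> i (smul c u) = smul c (\<sigma> i u)" "\<sigma> i 1 = 1"
    using auto_T[OF i] by (auto simp: algebra_automorphism_on_def)
  have "\<sigma> i 0 = 0" using \<sigma>(1)[of 0 0] T by simp
  moreover have "S i * \<sigma> i (u * v) = u * v * S i"
    if "u \<in> T" "v \<in> T" "S i * \<sigma> i u = u * S i" "S i * \<sigma> i v = v * S i" for u v
  proof -
    have "S i * \<sigma> i (u * v) = (S i * \<sigma> i u) * \<sigma> i v"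
      by (simp add: \<sigma>(2)[OF that(1,2)] mult.assoc)
    also have "\<dots> = u * (S i * \<sigma> i v)" unfolding that(3) by (rule mult.assoc)
    finally show ?thesis using that(4) by (simp add: mult.assoc)
  qed
  ultimately have "subalgebra smul ?U"
    using T \<sigma> by (auto simp: subalgebra_def subspace_def distrib_left distrib_right
        simp flip: scale_mult_left scale_mult_right)
  moreover have "R \<union> D ` {..<n} \<subseteq> ?U"
    using S_\<sigma>_R[OF i] D_S i R_subset_T D_in_T by auto
  ultimately have "T \<subseteq> ?U" unfolding T_def using hull_minimal by blast
  then show ?thesis using t by blast
qed

text \<open>
  Elements past which nonzero scalars can be moved in both directions, at the price of changing
  the scalar.
\<close>

definition semicentral :: "'a set" where
  "semicentral = {y. (\<forall>c\<in>R - {0}. \<exists>c'\<in>R - {0}. y * c = c' * y) \<and>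
     (\<forall>c\<in>R - {0}. \<exists>c'\<in>R - {0}. c * y = y * c')}"

lemma semicentral_mult:
  assumes "y \<in> semicentral" "z \<in> semicentral"
  shows "y * z \<in> semicentral"
  unfolding semicentral_def
proof (intro CollectI conjI ballI)
  fix c assume "c \<in> R - {0}"
  then obtain c' where c': "c' \<in> R - {0}" "z * c = c' * z"
    using assms(2) unfolding semicentral_def by blast
  then obtain d where d: "d \<in> R - {0}" "y * c' = d * y"
    using assms(1) unfolding semicentral_def by blast
  have "y * z * c = d * (y * z)" using c' d by (simp add: mult.assoc) (simp flip: mult.assoc)
  then show "\<exists>c'\<in>R - {0}. y * z * c = c' * (y * z)" using d by blast
next
  fix c assume "c \<in> R - {0}"
  then obtain c' where c': "c' \<in> R - {0}" "c * y = y * c'"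
    using assms(1) unfolding semicentral_def by blast
  then obtain d where d: "d \<in> R - {0}" "c' * z = z * d"
    using assms(2) unfolding semicentral_def by blast
  have "c * (y * z) = y * z * d" using c' d by (simp add: mult.assoc flip: mult.assoc[of c])
  then show "\<exists>c'\<in>R - {0}. c * (y * z) = y * z * c'" using d by blast
qed

lemma semicentral_S: "i < m \<Longrightarrow> S i \<in> semicentral"
proof -
  assume i: "i < m"
  have bij: "bij_betw (\<sigma> i) R R" and add: "\<And>u v. u \<in> R \<Longrightarrow> v \<in> R \<Longrightarrow> \<sigma> i (u + v) = \<sigma> i u + \<sigma> i v"
    using auto_R[OF i] by (auto simp: algebra_automorphism_on_def)
  have zero: "\<sigma> i 0 = 0" using add[of 0 0] R_zero by simp
  have into: "\<sigma> i c \<in> R - {0}" if "c \<in> R - {0}" for c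
  proof -
    have "\<sigma> i c \<noteq> \<sigma> i 0"
      using inj_onD[OF bij_betw_imp_inj_on[OF bij], of c 0] that R_zero by auto
    then show ?thesis using bij_betwE[OF bij] that zero by auto
  qed
  have onto: "\<exists>b\<in>R - {0}. \<sigma> i b = c" if "c \<in> R - {0}" for c
  proof -
    have "c \<in> \<sigma> i ` R" using bij_betw_imp_surj_on[OF bij] that by simp
    then obtain b where "b \<in> R" "\<sigma> i b = c" by auto
    then show ?thesis using zero that by blast
  qed
  show ?thesis
    unfolding semicentral_def
  proof (intro CollectI conjI ballI)
    fix c assume c: "c \<in> R - {0}"
    show "\<exists>c'\<in>R - {0}. S i * c = c' * S i" using onto[OF c] S_\<sigma>_R[OF i] by blast
    show "\<exists>c'\<in>R - {0}. c * S i = S i * c'"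
      by (rule bexI[OF _ into[OF c]]) (use S_\<sigma>_R[OF i] c in simp)
  qed
qed

lemma semicentral_D: "i < n \<Longrightarrow> D i \<in> semicentral"
  unfolding semicentral_def using D_central[of i] by auto

lemma x_eq: "i < m \<Longrightarrow> x i = S i" "m \<le> i \<Longrightarrow> x i = D (i - m)"
  by (simp_all add: gens_def)

lemma semicentral_one: "1 \<in> semicentral"
  by (auto simp: semicentral_def)

lemma semicentral_power: "b \<le> m + n \<Longrightarrow> ordered_power x a b \<alpha> \<in> semicentral"
proof (rule ordered_power_in)
  fix i assume "b \<le> m + n" "i \<in> {a..<b}"
  then show "x i \<in> semicentral"
    using semicentral_S semicentral_D by (cases "i < m") (auto simp: x_eq)
qed (auto intro: semicentral_one semicentral_mult)

lemma semicentral_X: "X \<alpha> \<in> semicentral"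
  unfolding Xpow_split by (intro semicentral_mult semicentral_power) auto

lemma semicentral_swap:
  assumes "y \<in> semicentral" "c \<in> R"
  shows "\<exists>c'\<in>R. y * c = c' * y"
proof (cases "c = 0")
  case True
  then show ?thesis using R_zero by (intro bexI[of _ 0]) auto
qed (use assms in \<open>auto simp: semicentral_def\<close>)

text \<open>
  The \<open>R\<close>-span of the \<open>D s\<close> is stable under \<open>\<sigma> i\<close>, so it can be moved to the right past the \<open>S i\<close>
  without leaving degree one. This controls which monomials occur in \<open>D j * X \<alpha>\<close>.
\<close>

definition D_span :: "'a set" where
  "D_span = {\<Sum>s<n. b s * D s | b. \<forall>s<n. b s \<in> R}"

lemma D_spanI: "(\<And>s. s < n \<Longrightarrow> b s \<in> R) \<Longrightarrow> (\<Sum>s<n. b s * D s) \<in> D_span"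
  unfolding D_span_def by blast

lemma D_spanE:
  assumes "v \<in> D_span"
  obtains b where "\<And>s. s < n \<Longrightarrow> b s \<in> R" "v = (\<Sum>s<n. b s * D s)"
  using assms unfolding D_span_def by blast

lemma D_span_sum: "finite F \<Longrightarrow> (\<And>i. i \<in> F \<Longrightarrow> f i \<in> D_span) \<Longrightarrow> sum f F \<in> D_span"
proof (induction F rule: finite_induct)
  case empty
  show ?case using D_spanI[of "\<lambda>_. 0"] R_zero by simp
next
  case (insert i F)
  obtain b where b: "\<And>s. s < n \<Longrightarrow> b s \<in> R" "f i = (\<Sum>s<n. b s * D s)"
    using D_spanE[of "f i"] insert.prems by blast
  obtain c where c: "\<And>s. s < n \<Longrightarrow> c s \<in> R" "sum f F = (\<Sum>s<n. c s * D s)"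
    using D_spanE[of "sum f F"] insert by blast
  have "sum f (insert i F) = (\<Sum>s<n. (b s + c s) * D s)"
    using insert.hyps b(2) c(2) by (simp add: distrib_right sum.distrib)
  then show ?case using D_spanI[of "\<lambda>s. b s + c s"] b(1) c(1) R_add by simp
qed

lemma D_in_span: "j < n \<Longrightarrow> D j \<in> D_span"
proof -
  assume j: "j < n"
  have "(\<Sum>s<n. (if s = j then 1 else 0) * D s) = (\<Sum>s<n. if s = j then D s else 0)"
    by (intro sum.cong) auto
  also have "\<dots> = D j" using j by simp
  finally show ?thesis
    using D_spanI[of "\<lambda>s. if s = j then 1 else 0"] R_one R_zero by simp
qed

lemma D_span_scale: "r \<in> R \<Longrightarrow> v \<in> D_span \<Longrightarrow> r * v \<in> D_span"
proof -
  assume r: "r \<in> R" and "v \<in> D_span"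
  then obtain b where b: "\<And>s. s < n \<Longrightarrow> b s \<in> R" "v = (\<Sum>s<n. b s * D s)"
    using D_spanE by blast
  have "r * v = (\<Sum>s<n. (r * b s) * D s)" by (simp add: b(2) sum_distrib_left mult.assoc)
  then show ?thesis using D_spanI[of "\<lambda>s. r * b s"] b(1) R_mult[OF r] by simp
qed

lemma D_span_past_S:
  assumes "v \<in> D_span"
  shows "\<exists>v'\<in>D_span. v * ordered_power x 0 m \<alpha> = ordered_power x 0 m \<alpha> * v'"
proof -
  let ?Q = "{p. \<forall>v\<in>D_span. \<exists>v'\<in>D_span. v * p = p * v'}"
  have "ordered_power x 0 m \<alpha> \<in> ?Q"
  proof (rule ordered_power_in)
    show "p * q \<in> ?Q" if "p \<in> ?Q" "q \<in> ?Q" for p q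
    proof (intro CollectI ballI)
      fix v assume "v \<in> D_span"
      then obtain v' where v': "v' \<in> D_span" "v * p = p * v'" using \<open>p \<in> ?Q\<close> by blast
      then obtain v'' where v'': "v'' \<in> D_span" "v' * q = q * v''" using \<open>q \<in> ?Q\<close> by blast
      have "v * (p * q) = p * q * v''"
        using v' v'' by (simp add: mult.assoc flip: mult.assoc[of v])
      then show "\<exists>v'\<in>D_span. v * (p * q) = p * q * v'" using v'' by blast
    qed
    fix i assume "i \<in> {0..<m}"
    then have i: "i < m" by simp
    show "x i \<in> ?Q"
    proof (intro CollectI ballI)
      fix v assume "v \<in> D_span"
      then obtain b where b: "\<And>s. s < n \<Longrightarrow> b s \<in> R" "v = (\<Sum>s<n. b s * D s)"
        using D_spanE by blast
      have bR: "\<sigma> i (b s) \<in> R" if "s < n" for s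
        using auto_R[OF i] bij_betwE b(1)[OF that] unfolding algebra_automorphism_on_def by blast
      have "v * S i = (\<Sum>s<n. b s * (D s * S i))"
        by (simp add: b(2) sum_distrib_right mult.assoc)
      also have "\<dots> = (\<Sum>s<n. S i * (\<sigma> i (b s) * \<sigma> i (D s)))"
      proof (rule sum.cong)
        fix s assume "s \<in> {..<n}"
        then have s: "s < n" by simp
        have "b s * (D s * S i) = (b s * S i) * \<sigma> i (D s)"
          using D_S[OF s i] by (simp add: mult.assoc)
        also have "b s * S i = S i * \<sigma> i (b s)" using S_\<sigma>_R[OF i] b(1) s by simp
        finally show "b s * (D s * S i) = S i * (\<sigma> i (b s) * \<sigma> i (D s))"
          by (simp add: mult.assoc)
      qed simp
      also have "\<dots> = S i * (\<Sum>s<n. \<sigma> i (b s) * \<sigma> i (D s))" by (simp add: sum_distrib_left)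
      finally have "v * S i = S i * (\<Sum>s<n. \<sigma> i (b s) * \<sigma> i (D s))" .
      moreover have "(\<Sum>s<n. \<sigma> i (b s) * \<sigma> i (D s)) \<in> D_span"
      proof (rule D_span_sum)
        fix s assume "s \<in> {..<n}"
        then have s: "s < n" by simp
        have "\<sigma> i (D s) \<in> D_span" using \<sigma>_D[OF i s] D_spanI by metis
        then show "\<sigma> i (b s) * \<sigma> i (D s) \<in> D_span" using bR[OF s] by (rule D_span_scale[rotated])
      qed simp
      ultimately show "\<exists>v'\<in>D_span. v * x i = x i * v'" using x_eq(1)[OF i] by auto
    qed
  qed auto
  then show ?thesis using assms by blast
qed

text \<open>
  Moving an element of \<open>T\<close> to the left past \<open>S i\<close> applies the inverse of \<open>\<sigma> i\<close>, whose values on the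
  \<open>D j\<close> are only known to lie in \<open>T\<close>. That suffices to write monomials as left multiples.
\<close>

lemma S_past_T:
  assumes "t \<in> T"
  shows "\<exists>t'\<in>T. ordered_power x 0 m \<alpha> * t = t' * ordered_power x 0 m \<alpha>"
proof -
  let ?Q = "{p. \<forall>t\<in>T. \<exists>t'\<in>T. p * t = t' * p}"
  have "ordered_power x 0 m \<alpha> \<in> ?Q"
  proof (rule ordered_power_in)
    show "p * q \<in> ?Q" if "p \<in> ?Q" "q \<in> ?Q" for p q
    proof (intro CollectI ballI)
      fix t assume "t \<in> T"
      then obtain t' where t': "t' \<in> T" "q * t = t' * q" using \<open>q \<in> ?Q\<close> by blast
      then obtain t'' where t'': "t'' \<in> T" "p * t' = t'' * p" using \<open>p \<in> ?Q\<close> by blast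
      have "p * q * t = t'' * (p * q)"
        using t' t'' by (simp add: mult.assoc) (simp flip: mult.assoc)
      then show "\<exists>t'\<in>T. p * q * t = t' * (p * q)" using t'' by blast
    qed
    fix i assume "i \<in> {0..<m}"
    then have i: "i < m" by simp
    show "x i \<in> ?Q"
    proof (intro CollectI ballI)
      fix t assume "t \<in> T"
      then have "t \<in> \<sigma> i ` T"
        using auto_T[OF i] by (simp add: algebra_automorphism_on_def bij_betw_def)
      then obtain u where "u \<in> T" "t = \<sigma> i u" by blast
      then show "\<exists>t'\<in>T. x i * t = t' * x i" using S_\<sigma>_T[OF i] x_eq(1)[OF i] by auto
    qed
  qed auto
  then show ?thesis using assms by blast
qed

lemma S_mult_X: "j < m \<Longrightarrow> x j * X \<alpha> = X (\<alpha>(j := Suc (\<alpha> j)))"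
proof -
  assume j: "j < m"
  have "x j * ordered_power x 0 m \<alpha> = ordered_power x 0 m (\<alpha>(j := Suc (\<alpha> j)))"
    by (rule ordered_power_mult_commuting) (use j S_comm in \<open>auto simp: x_eq\<close>)
  then show ?thesis
    using j by (simp add: Xpow_split ordered_power_update flip: mult.assoc)
qed

lemma X_update_D:
  assumes "m \<le> j" "j < m + n"
  shows "X (\<alpha>(j := Suc (\<alpha> j)))
    = ordered_power x 0 m \<alpha> * (x j * ordered_power x m (m + n) \<alpha>)"
proof -
  have "x j * ordered_power x m (m + n) \<alpha> = ordered_power x m (m + n) (\<alpha>(j := Suc (\<alpha> j)))"
    by (rule ordered_power_mult_commuting) (use assms D_comm in \<open>auto simp: x_eq\<close>)
  then show ?thesis
    using assms by (simp add: Xpow_split ordered_power_update)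
qed

lemma X_update_last:
  assumes "j < m + n" "Suc j = m + n"
  shows "X \<alpha> * x j = X (\<alpha>(j := Suc (\<alpha> j)))"
proof -
  have "X \<alpha> = ordered_power x 0 (Suc j) \<alpha>" for \<alpha>
    using assms by (simp add: Xpow_def ordered_power_def)
  moreover have "ordered_power x 0 j (\<alpha>(j := Suc (\<alpha> j))) = ordered_power x 0 j \<alpha>"
    by (rule ordered_power_update) simp
  ultimately show ?thesis
    by (simp add: ordered_power_Suc mult.assoc power_commutes fun_upd_def)
qed

text \<open>
  A product with \<open>D j\<close> may replace \<open>D j\<close> by other \<open>D s\<close>, but never lowers an exponent.
\<close>

lemma D_mult_X:
  assumes "m \<le> j" "j < m + n"
  shows "\<exists>b. (\<forall>s<n. b s \<in> R) \<and>
    x j * X \<alpha> = (\<Sum>s<n. b s * X (\<alpha>(m + s := Suc (\<alpha> (m + s)))))"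
proof -
  let ?S = "ordered_power x 0 m \<alpha>" and ?D = "ordered_power x m (m + n) \<alpha>"
  have "x j \<in> D_span" using assms D_in_span[of "j - m"] by (simp add: x_eq)
  then obtain v where "v \<in> D_span" "x j * ?S = ?S * v" using D_span_past_S by blast
  then obtain b where b: "\<And>s. s < n \<Longrightarrow> b s \<in> R" "x j * ?S = ?S * (\<Sum>s<n. b s * D s)"
    using D_spanE by metis
  have "\<exists>c. c \<in> R \<and> ?S * b s = c * ?S" if "s < n" for s
    using semicentral_swap[OF semicentral_power[of m 0 \<alpha>] b(1)[OF that]] by auto
  then have "\<forall>s\<in>{..<n}. \<exists>c. c \<in> R \<and> ?S * b s = c * ?S" by simp
  from bchoice[OF this] obtain c where "\<forall>s\<in>{..<n}. c s \<in> R \<and> ?S * b s = c s * ?S" ..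
  then have c: "\<And>s. s < n \<Longrightarrow> c s \<in> R" "\<And>s. s < n \<Longrightarrow> ?S * b s = c s * ?S" by simp_all
  have "x j * X \<alpha> = (x j * ?S) * ?D" by (simp add: Xpow_split mult.assoc)
  also have "\<dots> = (\<Sum>s<n. (?S * b s) * (D s * ?D))"
    unfolding b(2) by (simp add: sum_distrib_left sum_distrib_right mult.assoc)
  also have "\<dots> = (\<Sum>s<n. c s * X (\<alpha>(m + s := Suc (\<alpha> (m + s)))))"
    by (intro sum.cong refl, subst X_update_D) (auto simp: c x_eq mult.assoc)
  finally show ?thesis using c(1) by blast
qed

lemma X_step_multiple:
  assumes "j < m + n"
  shows "\<exists>h. h * X \<alpha> = X (\<alpha>(j := Suc (\<alpha> j)))"
proof (cases "j < m")
  case True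
  then show ?thesis using S_mult_X by blast
next
  case False
  then have "x j \<in> T" using assms D_in_T[of "j - m"] by (simp add: x_eq)
  then obtain t where "ordered_power x 0 m \<alpha> * x j = t * ordered_power x 0 m \<alpha>"
    using S_past_T by blast
  then have "X (\<alpha>(j := Suc (\<alpha> j))) = t * X \<alpha>"
    using X_update_D[of j \<alpha>] False assms
    by (simp add: Xpow_split flip: mult.assoc)
  then show ?thesis by metis
qed

lemma X_multiple:
  assumes "\<alpha> \<in> expos (m + n)" "\<beta> \<in> expos (m + n)" "\<And>s. s < m + n \<Longrightarrow> \<beta> s \<le> \<alpha> s"
  shows "\<exists>h. h * X \<beta> = X \<alpha>"
  using assms
proof (induction "\<Sum>s<m + n. \<alpha> s - \<beta> s" arbitrary: \<alpha> rule: less_induct)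
  case less
  show ?case
  proof (cases "\<exists>j<m + n. \<beta> j < \<alpha> j")
    case False
    have "\<alpha> s = \<beta> s" for s
    proof (cases "s < m + n")
      case True
      then have "\<not> \<beta> s < \<alpha> s" using False by blast
      then show ?thesis using less.prems(3)[OF True] by simp
    qed (use less.prems(1,2) in \<open>simp add: expos_def\<close>)
    then have "\<alpha> = \<beta>" by blast
    then show ?thesis by (auto intro: exI[of _ 1])
  next
    case True
    then obtain j where j: "j < m + n" "\<beta> j < \<alpha> j" by blast
    let ?\<gamma> = "\<alpha>(j := \<alpha> j - 1)"
    have "(\<Sum>s<m + n. ?\<gamma> s - \<beta> s) < (\<Sum>s<m + n. \<alpha> s - \<beta> s)"
      by (rule sum_strict_mono_ex1) (use j in auto)
    moreover have "?\<gamma> \<in> expos (m + n)" "\<And>s. s < m + n \<Longrightarrow> \<beta> s \<le> ?\<gamma> s"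
      using less.prems j by (auto simp: expos_def)
    ultimately obtain h where h: "h * X \<beta> = X ?\<gamma>" using less.hyps less.prems(2) by blast
    have "?\<gamma>(j := Suc (?\<gamma> j)) = \<alpha>" using j by auto
    then obtain g where "g * X ?\<gamma> = X \<alpha>" using X_step_multiple[OF j(1), of ?\<gamma>] by metis
    then have "(g * h) * X \<beta> = X \<alpha>" using h by (simp add: mult.assoc)
    then show ?thesis by blast
  qed
qed

sublocale coords_A: free_left_module "(*)" R "expos (m + n)" X
  by unfold_locales
    (auto intro: X_basis R_one R_add R_neg R_mult simp: distrib_left distrib_right mult.assoc)

text \<open>
  Reduces a statement on left multiplication by arbitrary algebra elements to scalars and single
  generators.
\<close>

lemma generation_induct [case_names scalar gen mult add]:
  assumes "\<And>r. r \<in> R \<Longrightarrow> P r" "\<And>j. j < m + n \<Longrightarrow> P (x j)"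
    and mult: "\<And>a b. P a \<Longrightarrow> P b \<Longrightarrow> P (a * b)" and add: "\<And>a b. P a \<Longrightarrow> P b \<Longrightarrow> P (a + b)"
  shows "P a"
proof -
  have X: "X \<alpha> \<in> {a. P a}" for \<alpha>
    using ordered_power_in[of "{a. P a}" 0 "m + n" x \<alpha>] assms R_one
    by (auto simp: Xpow_def ordered_power_def)
  have "P (\<Sum>\<alpha>\<in>F. coords_A.coef a \<alpha> * X \<alpha>)" for F
    by (induction F rule: infinite_finite_induct)
      (use X in \<open>auto intro: assms(1) R_zero mult add coords_A.coef_in_R\<close>)
  then show ?thesis by (subst coords_A.expansion)
qed

end


section \<open>Monomial vectors\<close>

locale dd_over_field_ordered = dd_over_field smul R m n S D \<sigma> \<delta>
  for smul :: "'k::field_char_0 \<Rightarrow> 'a::ring_1 \<Rightarrow> 'a"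
    and R :: "'a set" and m n :: nat and S D :: "nat \<Rightarrow> 'a" and \<sigma> \<delta> :: "nat \<Rightarrow> 'a \<Rightarrow> 'a" +
  fixes le :: "('a ^ 'p::finite) rel"
  assumes ordering: "dd_monomial_ordering R (monomials (m + n) (gens m S D)) le"
begin

abbreviation N :: "('a ^ 'p) set" where "N \<equiv> monomials (m + n) x"
abbreviation mon :: "(nat \<Rightarrow> nat) \<Rightarrow> 'p \<Rightarrow> 'a ^ 'p" where "mon \<equiv> monom_vec (m + n) x"
abbreviation E :: "(nat \<Rightarrow> nat) set" where "E \<equiv> expos (m + n)"

sublocale pairs: free_left_module "(*s)" R "E \<times> (UNIV :: 'p set)" "\<lambda>(\<alpha>, i). mon \<alpha> i"
proof unfold_locales
  show "left_basis (*s) R (E \<times> (UNIV :: 'p set)) (\<lambda>(\<alpha>, i). mon \<alpha> i)"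
    unfolding monom_vec_def by (rule left_basis_vec[OF coords_A.free_left_module_axioms])
qed (auto intro: R_one R_add R_neg R_mult simp: vec_eq_iff algebra_simps)

lemma N_eq: "N = (\<lambda>(\<alpha>, i). mon \<alpha> i) ` (E \<times> UNIV)"
  by (auto simp: monomials_def)

sublocale free_left_module "(*s)" R N "\<lambda>u. u"
proof unfold_locales
  show "left_basis (*s) R N (\<lambda>u. u)" unfolding N_eq by (rule pairs.left_basis_image)
qed (auto intro: R_one R_add R_neg R_mult simp: vec_eq_iff algebra_simps)

lemma mcoeff_eq: "mcoeff R N f v = coef f v"
  by (simp add: mcoeff_def)

lemma mon_in: "\<alpha> \<in> E \<Longrightarrow> mon \<alpha> i \<in> N"
  by (auto simp: monomials_def)

lemma mon_cases:
  assumes "u \<in> N"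
  obtains \<alpha> i where "\<alpha> \<in> E" "u = mon \<alpha> i"
  using assms by (auto simp: monomials_def)

lemma mon_inject: "\<alpha> \<in> E \<Longrightarrow> \<beta> \<in> E \<Longrightarrow> mon \<alpha> i = mon \<beta> j \<Longrightarrow> \<alpha> = \<beta> \<and> i = j"
  using inj_onD[OF pairs.inj_on_basis, of "(\<alpha>, i)" "(\<beta>, j)"] by simp

lemma monom_index_mon: "\<alpha> \<in> E \<Longrightarrow> monom_index (m + n) x (mon \<alpha> i) = (\<alpha>, i)"
  unfolding monom_index_def
  using inv_into_f_f[OF pairs.inj_on_basis, of "(\<alpha>, i)"] by simp

lemma R_no_zero_divisors: "r \<in> R \<Longrightarrow> r \<noteq> 0 \<Longrightarrow> s \<noteq> 0 \<Longrightarrow> r * s \<noteq> 0"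
  using R_inverse[of r] by (metis mult.assoc mult_1 mult_zero_right)

text \<open>
  Scaling all components from the right does not commute with the expansion into monomials, but
  it commutes with left multiplication by the algebra.
\<close>

definition right_scale :: "'a ^ 'p \<Rightarrow> 'a \<Rightarrow> 'a ^ 'p" where
  "right_scale f c = (\<chi> k. f $ k * c)"

lemma right_scale_add: "right_scale (f + g) c = right_scale f c + right_scale g c"
  and right_scale_zero: "right_scale 0 c = 0"
  and right_scale_left: "right_scale (a *s f) c = a *s right_scale f c"
  by (simp_all add: right_scale_def vec_eq_iff distrib_right mult.assoc)

lemma right_scale_sum: "right_scale (sum f F) c = (\<Sum>i\<in>F. right_scale (f i) c)"
  by (induction F rule: infinite_finite_induct) (simp_all add: right_scale_zero right_scale_add)

lemma right_scale_mon: "X \<alpha> * c = c' * X \<alpha> \<Longrightarrow> right_scale (mon \<alpha> i) c = c' *s mon \<alpha> i"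
  by (auto simp: right_scale_def monom_vec_def vec_eq_iff axis_def)

text \<open>
  Each monomial \<open>u\<close> turns the right factor \<open>c\<close> into a left factor \<open>t u \<noteq> 0\<close>, which depends on \<open>u\<close>.
\<close>

lemma support_right_scale:
  assumes c: "c \<in> R - {0}"
  shows "coef (right_scale f c) v \<noteq> 0 \<longleftrightarrow> coef f v \<noteq> 0"
proof -
  have "\<exists>t. t \<in> R - {0} \<and> right_scale u c = t *s u" if "u \<in> N" for u
  proof -
    obtain \<alpha> i where u: "u = mon \<alpha> i" using mon_cases[OF \<open>u \<in> N\<close>] by metis
    obtain t where "t \<in> R - {0}" "X \<alpha> * c = t * X \<alpha>"
      using semicentral_X[of \<alpha>] c unfolding semicentral_def by blast
    then show ?thesis using right_scale_mon u by blast
  qed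
  then have "\<forall>u\<in>N. \<exists>t. t \<in> R - {0} \<and> right_scale u c = t *s u" by blast
  from bchoice[OF this] obtain t
    where t: "\<And>u. u \<in> N \<Longrightarrow> t u \<in> R - {0}" "\<And>u. u \<in> N \<Longrightarrow> right_scale u c = t u *s u" by auto
  let ?F = "{u. coef f u \<noteq> 0}"
  have "right_scale f c = (\<Sum>u\<in>?F. coef f u *s right_scale u c)"
    using arg_cong[OF expansion[of f], of "\<lambda>g. right_scale g c"]
    unfolding right_scale_sum right_scale_left .
  also have "\<dots> = (\<Sum>u\<in>?F. (coef f u * t u) *s u)"
    using support_subset by (intro sum.cong) (auto simp: t(2) act_mult)
  finally have "coef (right_scale f c) v = (\<Sum>u\<in>?F. coef ((coef f u * t u) *s u) v)"
    by (simp add: coef_sum)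
  also have "\<dots> = (\<Sum>u\<in>?F. if u = v then coef f u * t u else 0)"
  proof (rule sum.cong)
    fix u assume "u \<in> ?F"
    then have "u \<in> N" using support_subset by blast
    moreover from this have "coef f u * t u \<in> R" using t(1) coef_in_R R_mult by blast
    ultimately show "coef ((coef f u * t u) *s u) v = (if u = v then coef f u * t u else 0)"
      by (simp add: coef_scale coef_basis)
  qed simp
  also have "\<dots> = (if coef f v \<noteq> 0 then coef f v * t v else 0)"
    by (simp add: sum.delta[OF finite_support])
  finally show ?thesis
    using R_no_zero_divisors[OF coef_in_R[of f v], of "t v"] t(1)[OF support_subset[of f v]] by auto
qed

text \<open>
  Moving \<open>c\<close> to the right end of \<open>u\<close> turns \<open>a *s (c *s u)\<close> into a right scaling of \<open>a *s u\<close>.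
\<close>

lemma support_rescale_mon:
  assumes "u \<in> N" "c \<in> R" "c \<noteq> 0"
  shows "coef (a *s (c *s u)) v \<noteq> 0 \<longleftrightarrow> coef (a *s u) v \<noteq> 0"
proof -
  obtain \<alpha> i where u: "u = mon \<alpha> i" using mon_cases[OF assms(1)] by metis
  obtain c' where c': "c' \<in> R - {0}" "c * X \<alpha> = X \<alpha> * c'"
    using semicentral_X[of \<alpha>] assms unfolding semicentral_def by blast
  have "c *s u = right_scale u c'" unfolding u using right_scale_mon c'(2) by metis
  then have "a *s (c *s u) = right_scale (a *s u) c'" by (simp add: right_scale_left)
  then show ?thesis using support_right_scale[OF c'(1)] by simp
qed

definition multiples :: "'a ^ 'p \<Rightarrow> ('a ^ 'p) set" where
  "multiples u = {f. \<forall>v. coef f v \<noteq> 0 \<longrightarrow> right_divisible (m + n) x v u}"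

lemma multiples_add: "f \<in> multiples u \<Longrightarrow> g \<in> multiples u \<Longrightarrow> f + g \<in> multiples u"
  unfolding multiples_def by (auto simp: coef_add) (metis add.right_neutral)

lemma multiples_scale: "r \<in> R \<Longrightarrow> f \<in> multiples u \<Longrightarrow> r *s f \<in> multiples u"
  unfolding multiples_def by (auto simp: coef_scale dest!: mult_not_zero)

lemma multiples_zero: "0 \<in> multiples u"
  by (simp add: multiples_def coef_zero)

lemma multiples_sum: "(\<And>i. i \<in> F \<Longrightarrow> f i \<in> multiples u) \<Longrightarrow> sum f F \<in> multiples u"
  by (induction F rule: infinite_finite_induct) (auto intro: multiples_zero multiples_add)

lemma multiples_mon:
  assumes "right_divisible (m + n) x w u"
  shows "w \<in> multiples u"
proof -
  have "w \<in> N" using assms mon_in unfolding right_divisible_def by blast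
  then show ?thesis using assms by (auto simp: multiples_def coef_basis)
qed

lemma multiples_gen:
  assumes j: "j < m + n" and w: "right_divisible (m + n) x w u"
  shows "x j *s w \<in> multiples u"
proof -
  obtain \<alpha> \<beta> i where \<alpha>: "\<alpha> \<in> E" "\<beta> \<in> E" "w = mon \<alpha> i" "u = mon \<beta> i" "\<forall>s<m + n. \<beta> s \<le> \<alpha> s"
    using w unfolding right_divisible_def by blast
  have up: "mon (\<alpha>(k := Suc (\<alpha> k))) i \<in> multiples u" if "k < m + n" for k
  proof (rule multiples_mon)
    have "\<alpha>(k := Suc (\<alpha> k)) \<in> E" "\<forall>s<m + n. \<beta> s \<le> (\<alpha>(k := Suc (\<alpha> k))) s"
      using \<alpha> that by (auto simp: expos_def le_Suc_eq)
    then show "right_divisible (m + n) x (mon (\<alpha>(k := Suc (\<alpha> k))) i) u"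
      using \<alpha> unfolding right_divisible_def by blast
  qed
  have xw: "x j *s w = (x j * X \<alpha>) *s axis i 1" unfolding \<alpha>(3) monom_vec_def by (simp add: act_mult)
  show ?thesis
  proof (cases "j < m")
    case True
    then have "x j *s w = mon (\<alpha>(j := Suc (\<alpha> j))) i"
      unfolding xw monom_vec_def by (simp add: S_mult_X)
    then show ?thesis using up[OF j] by simp
  next
    case False
    then obtain b where b: "\<forall>s<n. b s \<in> R"
      "x j * X \<alpha> = (\<Sum>s<n. b s * X (\<alpha>(m + s := Suc (\<alpha> (m + s)))))"
      using D_mult_X[of j \<alpha>] j by auto
    have "x j *s w = (\<Sum>s<n. b s *s mon (\<alpha>(m + s := Suc (\<alpha> (m + s)))) i)"
      unfolding xw b(2) monom_vec_def
      by (simp add: vec_eq_iff sum_distrib_right mult.assoc)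
    also have "\<dots> \<in> multiples u"
      using b(1) up by (intro multiples_sum multiples_scale) auto
    finally show ?thesis .
  qed
qed

text \<open>
  Applied to \<open>u\<close> itself, this shows that all monomials of \<open>a *s u\<close> are divisible by \<open>u\<close>.
\<close>

lemma multiples_closed: "f \<in> multiples u \<Longrightarrow> a *s f \<in> multiples u"
proof (induction a arbitrary: f rule: generation_induct)
  case (gen j)
  have "x j *s (coef f v *s v) \<in> multiples u" if v: "coef f v \<noteq> 0" for v
  proof -
    have "x j \<in> semicentral"
      using gen(1) semicentral_S semicentral_D by (cases "j < m") (auto simp: x_eq)
    then obtain r where r: "r \<in> R" "x j * coef f v = r * x j"
      using semicentral_swap coef_in_R by metis
    have "right_divisible (m + n) x v u" using v gen(2) by (simp add: multiples_def)
    then have "r *s (x j *s v) \<in> multiples u" using multiples_gen multiples_scale gen(1) r by blast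
    then show ?thesis using r(2) by (simp flip: act_mult)
  qed
  moreover have "x j *s f = (\<Sum>v | coef f v \<noteq> 0. x j *s (coef f v *s v))"
    using arg_cong[OF expansion[of f], of "(*s) (x j)"] unfolding act_sum_right .
  ultimately show ?case using multiples_sum[of "{v. coef f v \<noteq> 0}"] by simp
qed (simp_all add: multiples_scale act_mult act_add multiples_add)

text \<open>
  An element \<open>a\<close> that kills \<open>X\<^sup>\<alpha>\<close> also kills the product of \<open>X\<^sup>\<alpha>\<close> with the last generator, which is
  another monomial. A nonzero \<open>a\<close> cannot kill both, because the ordering compares their images
  strictly.
\<close>

lemma cancel_mon:
  assumes u: "u \<in> N" and a: "a *s u = 0"
  shows "a = 0"
proof (rule ccontr)
  assume nz: "a \<noteq> 0"
  obtain \<alpha> i where \<alpha>: "\<alpha> \<in> E" "u = mon \<alpha> i" using mon_cases[OF u] by metis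
  have "(a *s u) $ i = a * X \<alpha>" by (simp add: \<alpha> monom_vec_def)
  then have zero: "a * X \<alpha> = 0" using a by simp
  show False
  proof (cases "m + n = 0")
    case True
    then show ?thesis using zero nz by (simp add: Xpow_def)
  next
    case False
    \<comment> \<open>Only the last generator can be multiplied to a monomial from the right without reordering.\<close>
    let ?j = "m + n - 1"
    let ?\<beta> = "\<alpha>(?j := Suc (\<alpha> ?j))"
    let ?v = "mon ?\<beta> i"
    have \<beta>: "?\<beta> \<in> E" using \<alpha> False by (auto simp: expos_def)
    have "a * X ?\<beta> = a * X \<alpha> * x ?j"
      using X_update_last[of ?j \<alpha>] False by (simp add: mult.assoc)
    then have v0: "a *s ?v = 0" using zero by (simp add: monom_vec_def vec_eq_iff flip: mult.assoc)
    have "?v \<noteq> u"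
    proof
      assume "?v = u"
      then have "?\<beta> = \<alpha>" using mon_inject[OF \<beta> \<alpha>(1)] \<alpha>(2) by blast
      then show False by (metis fun_upd_same n_not_Suc_n)
    qed
    moreover have "?v \<in> N" by (rule mon_in[OF \<beta>])
    moreover have "total_on N le"
      using ordering by (simp add: dd_monomial_ordering_def order_on_defs)
    ultimately have "(?v, u) \<in> le - Id \<or> (u, ?v) \<in> le - Id"
      using u by (auto simp: total_on_def)
    then have "(lm R N le 0, lm R N le 0) \<in> le - Id"
      using ordering nz u \<open>?v \<in> N\<close> a v0 unfolding dd_monomial_ordering_def by metis
    then show False by simp
  qed
qed

lemma lclm_mon:
  "\<alpha> \<in> E \<Longrightarrow> \<beta> \<in> E \<Longrightarrow> lclm (m + n) x (mon \<alpha> i) (mon \<beta> i) = mon (\<lambda>s. max (\<alpha> s) (\<beta> s)) i"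
  by (simp add: lclm_def monom_index_mon)

sublocale monomial_module R N le "right_divisible (m + n) x" "lclm (m + n) x"
proof unfold_locales
  show "dd_monomial_ordering R N le" by (rule ordering)
  show "\<exists>d\<in>R. d * c = 1" if "c \<in> R" "c \<noteq> 0" for c using R_inverse that .
  show "mcoeff R N (a *s (c *s u)) v \<noteq> 0 \<longleftrightarrow> mcoeff R N (a *s u) v \<noteq> 0"
    if "u \<in> N" "c \<in> R" "c \<noteq> 0" for u v c a
    unfolding mcoeff_eq by (rule support_rescale_mon[OF that])
  show "right_divisible (m + n) x v u" if u: "u \<in> N" and v: "mcoeff R N (a *s u) v \<noteq> 0" for u v :: "'a ^ 'p" and a
  proof -
    have "right_divisible (m + n) x u u"
      using u by (auto elim!: mon_cases simp: right_divisible_def)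
    then have "a *s u \<in> multiples u" using multiples_closed multiples_mon by blast
    then show ?thesis using v by (simp add: multiples_def mcoeff_eq)
  qed
  show "w \<in> N" "u \<in> N" if "right_divisible (m + n) x w u" for w u :: "'a ^ 'p"
    using that mon_in unfolding right_divisible_def by blast+
  show "\<exists>h. h *s u = w" if "right_divisible (m + n) x w u" for w u :: "'a ^ 'p"
  proof -
    obtain \<alpha> \<beta> i where "\<alpha> \<in> E" "\<beta> \<in> E" "w = mon \<alpha> i" "u = mon \<beta> i" "\<forall>s<m + n. \<beta> s \<le> \<alpha> s"
      using \<open>right_divisible (m + n) x w u\<close> unfolding right_divisible_def by blast
    moreover from this obtain h where "h * X \<beta> = X \<alpha>" using X_multiple by blast
    ultimately have "h *s u = w" by (simp add: monom_vec_def vec_eq_iff flip: mult.assoc)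
    then show ?thesis by blast
  qed
  show "a = 0" if "u \<in> N" "a *s u = 0" for u a using cancel_mon that .
  show "right_divisible (m + n) x (lclm (m + n) x u v) u \<and>
      right_divisible (m + n) x (lclm (m + n) x u v) v \<and>
      right_divisible (m + n) x w (lclm (m + n) x u v)"
    if wu: "right_divisible (m + n) x w u" and wv: "right_divisible (m + n) x w v" for w u v :: "'a ^ 'p"
  proof -
    obtain \<gamma> \<alpha> i where 1: "\<gamma> \<in> E" "\<alpha> \<in> E" "w = mon \<gamma> i" "u = mon \<alpha> i" "\<forall>s<m + n. \<alpha> s \<le> \<gamma> s"
      using wu unfolding right_divisible_def by blast
    obtain \<gamma>' \<beta> i' where 2: "\<gamma>' \<in> E" "\<beta> \<in> E" "w = mon \<gamma>' i'" "v = mon \<beta> i'"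
      "\<forall>s<m + n. \<beta> s \<le> \<gamma>' s"
      using wv unfolding right_divisible_def by blast
    have same: "\<gamma>' = \<gamma>" "i' = i" using mon_inject 1 2 by metis+
    let ?\<mu> = "\<lambda>s. max (\<alpha> s) (\<beta> s)"
    have \<mu>: "?\<mu> \<in> E" using 1(2) 2(2) by (simp add: expos_def)
    have lclm: "lclm (m + n) x u v = mon ?\<mu> i" using lclm_mon 1 2 same by simp
    have "\<forall>s<m + n. \<alpha> s \<le> ?\<mu> s" "\<forall>s<m + n. \<beta> s \<le> ?\<mu> s" "\<forall>s<m + n. ?\<mu> s \<le> \<gamma> s"
      using 1(5) 2(5) same by auto
    then show ?thesis
      unfolding lclm right_divisible_def using 1 2 same \<mu> by blast
  qed
qed

end

theorem theorem5p6:
  fixes smul :: "'k::field_char_0 \<Rightarrow> 'a::ring_1 \<Rightarrow> 'a"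
    and R :: "'a set" and m n :: nat and S D :: "nat \<Rightarrow> 'a"
    and \<sigma> \<delta> :: "nat \<Rightarrow> 'a \<Rightarrow> 'a"
    and le :: "('a ^ 'p::finite) rel" and G M :: "('a ^ 'p) set"
  assumes "dd_algebra smul R m n S D \<sigma> \<delta>"
    and "finite_field_extension smul R"
    and "dd_monomial_ordering R (monomials (m + n) (gens m S D)) le"
    and "0 \<notin> G"
    and "M = left_submodule hull G"
  shows "left_GS_basis R (m + n) (gens m S D) le M G \<longleftrightarrow>
    (\<forall>f\<in>G. \<forall>g\<in>G. reduces_to_0 R (monomials (m + n) (gens m S D)) le G
       (Svect R (m + n) (gens m S D) le f g))"
proof -
  interpret dd_over_field_ordered smul R m n S D \<sigma> \<delta> le
    using assms(1-3) by unfold_locales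
  have "G \<subseteq> M" unfolding assms(5) by (rule hull_subset)
  then show ?thesis
    using S_vect_criterion[OF assms(4,5)] assms(4)
    unfolding left_GS_basis_def Svect_def Let_def by blast
qed

end
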